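(* There exist real numbers $\alpha_0,\dots,\alpha_4$ satisfying the system $$\sum_{j=0}^{4}\cos\alpha_j=-\tfrac12,\qquad \sum_{j=0}^{4}\cos(2\alpha_j)=-\tfrac12,$$ $$\sum_{j=0}^{4}\cos\left(\alpha_j+\alpha_{(j+1+i)\bmod 5}\right)=-\tfrac12,\qquad \sum_{j=0}^{4}\cos\left(\alpha_j-\alpha_{(j+1+i)\bmod 5}\right)=-\tfrac12\qquad (i=0,1),$$ such that the associated $11\times 11$ matrix $L_{11}$, built from $c_j=e^{i\alpha_j}$ (here $i$ in the exponent is the imaginary unit), is a complex Hadamard matrix that is isolated and is not of the Butson type.
   Context: A complex Hadamard matrix of order $N$ is a matrix $H\in\mathbb{C}^{N\times N}$ all of whose entries have modulus $1$ and which satisfies $HH^{\dagger}=N\mathbb{I}_N$; the set of these is denoted $\mathbb{H}(N)$. Two matrices $H_1,H_2\in\mathbb{H}(N)$ are equivalent if $H_1=D_1P_1H_2P_2D_2$ for some diagonal unitary matrices $D_1,D_2$ and permutation matrices $P_1,P_2$. A matrix $H\in\mathbb{H}(N)$ is isolated if it has a neighborhood in $\mathbb{C}^{N\times N}$ (Euclidean topology) such that every complex Hadamard matrix in this neighborhood is equivalent to $H$. A matrix $H\in\mathbb{H}(N)$ is of the Butson type if there is $q\in\mathbb{N}$ such that every entry of $H$ is a $q$-th root of unity. Given unimodular numbers $c_0,\dots,c_4$, the matrix $L_{11}$ is $$L_{11}=\begin{bmatrix}1 & 1^{1\times 10}\\ 1^{10\times 1} & \mathrm{core}(L_{11})\end{bmatrix},$$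 where $1^{a\times b}$ is the all-ones $a\times b$ array, and $\mathrm{core}(L_{11})=\mathrm{circ}(C_0,C_1,C_2,C_3,C_4)$ is the $10\times 10$ block-circulant matrix whose first block row is $(C_0,C_1,C_2,C_3,C_4)$ and in which each subsequent block row is the previous one cyclically shifted by one block to the right, with $2\times2$ blocks $$C_j=\begin{bmatrix}c_j & c_j^*\\ c_j^* & c_j\end{bmatrix},$$ $^*$ denoting complex conjugation. *)

theory Defs
  imports "HOL-Analysis.Analysis"
begin

definition conj_transpose :: "complex^'n^'m \<Rightarrow> complex^'m^'n" where
  "conj_transpose A = map_matrix cnj (transpose A)"

definition complex_hadamard :: "complex^'n^'n \<Rightarrow> bool" where
  "complex_hadamard H \<longleftrightarrow>
     (\<forall>i j. cmod (H $ i $ j) = 1) \<and>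
     H ** conj_transpose H = real CARD('n) *\<^sub>R mat 1"

definition diagonal_unitary :: "complex^'n^'n \<Rightarrow> bool" where
  "diagonal_unitary D \<longleftrightarrow>
     (\<forall>i j. i \<noteq> j \<longrightarrow> D $ i $ j = 0) \<and>
     D ** conj_transpose D = mat 1 \<and> conj_transpose D ** D = mat 1"

definition permutation_matrix :: "complex^'n^'n \<Rightarrow> bool" where
  "permutation_matrix P \<longleftrightarrow>
     (\<exists>\<sigma>. \<sigma> permutes UNIV \<and> P = (\<chi> i j. if j = \<sigma> i then 1 else 0))"

definition hadamard_equivalent :: "complex^'n^'n \<Rightarrow> complex^'n^'n \<Rightarrow> bool" where
  "hadamard_equivalent H1 H2 \<longleftrightarrow>
     (\<exists>D1 P1 P2 D2. diagonal_unitary D1 \<and> diagonal_unitary D2 \<and>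
        permutation_matrix P1 \<and> permutation_matrix P2 \<and>
        H1 = D1 ** P1 ** H2 ** P2 ** D2)"

definition isolated_hadamard :: "complex^'n^'n \<Rightarrow> bool" where
  "isolated_hadamard H \<longleftrightarrow> complex_hadamard H \<and>
     (\<exists>U. open U \<and> H \<in> U \<and>
        (\<forall>K\<in>U. complex_hadamard K \<longrightarrow> hadamard_equivalent K H))"

definition butson_type :: "complex^'n^'n \<Rightarrow> bool" where
  "butson_type H \<longleftrightarrow> complex_hadamard H \<and>
     (\<exists>q::nat. q > 0 \<and> (\<forall>i j. (H $ i $ j) ^ q = 1))"

text \<open>
  Rows and columns of \<open>complex^11^11\<close> are indexed by the residue type \<open>11\<close>;
  \<open>pos\<close> sends an index to its representative in \<open>0,\<dots>,10\<close>, so that matrix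
  entries can be given by the usual formulas in natural numbers.
\<close>

definition pos :: "11 \<Rightarrow> nat" where
  "pos r = nat (Rep_bit1 r)"

lemma pos_of_nat: "m < 11 \<Longrightarrow> pos (of_nat m) = m"
  using bit1.Abs_inverse[where 'a=5, of "int m"] by (simp add: pos_def bit1.of_nat_eq)

lemma bij_betw_pos: "bij_betw pos UNIV {..<11}"
proof -
  have "{..<11} \<subseteq> range pos"
    by (metis lessThan_iff pos_of_nat rangeI subsetI)
  moreover have "pos r < 11" for r
    using bit1.Rep_less_n[of r] by (simp add: pos_def)
  moreover have "inj pos"
  proof (rule injI)
    fix r s :: 11
    assume "pos r = pos s"
    moreover have "0 \<le> Rep_bit1 r" "0 \<le> Rep_bit1 s"
      using Rep_bit1[of r] Rep_bit1[of s] by simp_all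
    ultimately have "Rep_bit1 r = Rep_bit1 s"
      by (simp add: pos_def)
    then show "r = s"
      by (simp add: Rep_bit1_inject)
  qed
  ultimately show ?thesis
    by (auto simp: bij_betw_def)
qed

definition C_block :: "complex \<Rightarrow> nat \<Rightarrow> nat \<Rightarrow> complex" where
  "C_block z a b = (if a = b then z else cnj z)"

text \<open>
  Entry \<open>(p, q)\<close> of \<open>circ(C\<^sub>0,\<dots>,C\<^sub>4)\<close>, counted from 0: it lies in block row \<open>k = p div 2\<close>
  and block column \<open>l = q div 2\<close>, and the block there is \<open>C\<^sub>j\<close> with \<open>j \<equiv> l - k\<close> modulo 5.
\<close>

definition core_L11 :: "(nat \<Rightarrow> complex) \<Rightarrow> nat \<Rightarrow> nat \<Rightarrow> complex" where
  "core_L11 c p q = C_block (c ((q div 2 + 5 - p div 2) mod 5)) (p mod 2) (q mod 2)"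

definition L11 :: "(nat \<Rightarrow> complex) \<Rightarrow> complex^11^11" where
  "L11 c = (\<chi> r s. if pos r = 0 \<or> pos s = 0 then 1
                   else core_L11 c (pos r - 1) (pos s - 1))"

end

theory Submission
  imports Defs "HOL-Computational_Algebra.Primes"
begin

text \<open>
  With \<open>a\<^sub>j = 2 cos \<alpha>\<^sub>j\<close> and \<open>b\<^sub>j = 2 sin \<alpha>\<^sub>j\<close> the system is equivalent to ten quadratic equations in ten unknowns.
  Newton's method, started at a decimal approximation and preconditioned by an approximate inverse
  of the Jacobian, maps a small cube into itself, so Brouwer's theorem yields an exact solution
  together with tight enclosures of the \<open>\<alpha>\<^sub>j\<close>.

  Isolation: a dephased Hadamard matrix near \<open>H = L\<^sub>1\<^sub>1\<close> is \<open>H\<^sub>i\<^sub>k exp(\<i> R\<^sub>i\<^sub>k)\<close> with a small real \<open>R\<close> that vanishes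
  on the first row and column, and orthogonality of its rows bounds the first order terms
  \<open>X\<^sub>i\<^sub>j = \<Sum>\<^sub>k H\<^sub>i\<^sub>k cnj(H\<^sub>j\<^sub>k) (R\<^sub>i\<^sub>k - R\<^sub>j\<^sub>k)\<close> by a multiple of \<open>max R\<^sup>2\<close>. Pairing \<open>X\<close> with a suitable skew-Hermitian
  matrix recovers an entry of \<open>R\<close> up to a small multiple of \<open>max R\<close>, hence \<open>R = 0\<close>. By the symmetries of \<open>L\<^sub>1\<^sub>1\<close>
  only five such matrices are needed; they were found numerically.

  Not Butson: if all \<open>c\<^sub>j\<close> were roots of unity of minimal common order \<open>q\<close>, then the vanishing sum
  \<open>1 + \<Sum>\<^sub>j (c\<^sub>j + cnj c\<^sub>j)\<close> and its Galois conjugates, together with the numerical fact that no proper subsum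
  \<open>1 + \<Sum>\<^sub>j\<^sub>\<in>\<^sub>J (c\<^sub>j + cnj c\<^sub>j)\<close> vanishes, force \<open>q\<close> to be squarefree, and for a prime factor \<open>p \<ge> 7\<close> they force
  \<open>c\<^sub>j^(2p) = 1\<close> for some \<open>j\<close> and \<open>p \<in> {7, 11}\<close> (Mann's argument). The enclosures refute this as well as \<open>c\<^sub>0^30 = 1\<close>.
\<close>

section \<open>Vanishing sums of roots of unity\<close>

text \<open>For positive \<open>q\<close> this is the ring generated by the \<open>q\<close>-th
  roots of unity. Building in only addition and negation gives an induction suited to additive maps;
  closure under products is derived.\<close>

inductive_set root_ring :: "nat \<Rightarrow> complex set" for q :: nat where
  root: "z ^ q = 1 \<Longrightarrow> z \<in> root_ring q"
| add: "x \<in> root_ring q \<Longrightarrow> y \<in> root_ring q \<Longrightarrow> x + y \<in> root_ring q"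
| minus: "x \<in> root_ring q \<Longrightarrow> - x \<in> root_ring q"

lemma zero_in_root_ring: "0 \<in> root_ring q"
  using root_ring.add[OF root_ring.root root_ring.minus[OF root_ring.root], of 1 q 1] by simp

lemma root_ring_mult:
  assumes "x \<in> root_ring q" "y \<in> root_ring q"
  shows "x * y \<in> root_ring q"
  using assms(1)
proof induction
  case (root z)
  note z = root
  show ?case using assms(2)
  proof induction
    case (root u)
    then show ?case using z by (intro root_ring.root) (simp add: power_mult_distrib)
  qed (auto simp: ring_distribs intro: root_ring.intros)
qed (auto simp: ring_distribs intro: root_ring.intros)

lemma root_ring_power: "x \<in> root_ring q \<Longrightarrow> x ^ n \<in> root_ring q"
  by (induction n) (auto intro: root_ring_mult root_ring.root)

lemma root_ring_sum: "(\<And>i. i \<in> I \<Longrightarrow> x i \<in> root_ring q) \<Longrightarrow> (\<Sum>i\<in>I. x i) \<in> root_ring q"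
  by (induction I rule: infinite_finite_induct) (auto intro: root_ring.add zero_in_root_ring)

lemma root_ring_of_nat: "of_nat n \<in> root_ring q"
proof (induction n)
  case (Suc n)
  have "(1::complex) \<in> root_ring q" by (rule root_ring.root) simp
  then show ?case using root_ring.add Suc by (simp add: add.commute)
qed (simp add: zero_in_root_ring)

text \<open>The Frobenius congruence modulo \<open>l\<close>: the inner binomial coefficients are
  divisible by the prime \<open>l\<close>.\<close>

lemma add_power_prime:
  assumes "prime l" "x \<in> root_ring q" "y \<in> root_ring q"
  shows "\<exists>g\<in>root_ring q. (x + y) ^ l = x ^ l + y ^ l + of_nat l * g"
proof -
  let ?g = "\<Sum>k\<in>{0<..<l}. of_nat ((l choose k) div l) * x ^ k * y ^ (l - k)"
  have l: "l > 0" using assms(1) by (simp add: prime_gt_0_nat)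
  have "{..l} = insert 0 (insert l {0<..<l})" using l by auto
  then have "(x + y) ^ l = y ^ l + x ^ l + (\<Sum>k\<in>{0<..<l}. of_nat (l choose k) * x ^ k * y ^ (l - k))"
    using l by (simp add: binomial_ring)
  also have "(\<Sum>k\<in>{0<..<l}. of_nat (l choose k) * x ^ k * y ^ (l - k)) = of_nat l * ?g"
    unfolding sum_distrib_left
  proof (rule sum.cong)
    fix k assume "k \<in> {0<..<l}"
    then have "l dvd (l choose k)" using assms(1) by (intro dvd_choose_prime) auto
    then have "of_nat (l choose k) = (of_nat l * of_nat ((l choose k) div l) :: complex)"
      by (metis dvd_mult_div_cancel of_nat_mult)
    then show "of_nat (l choose k) * x ^ k * y ^ (l - k) = of_nat l * (of_nat ((l choose k) div l) * x ^ k * y ^ (l - k))"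
      by simp
  qed simp
  finally show ?thesis
    by (intro bexI[of _ ?g] root_ring_sum root_ring_mult root_ring_power root_ring_of_nat assms) simp
qed

lemma sum_power_prime:
  assumes "prime l" "finite I" "\<And>i. i \<in> I \<Longrightarrow> x i \<in> root_ring q"
  shows "\<exists>g\<in>root_ring q. (\<Sum>i\<in>I. x i) ^ l = (\<Sum>i\<in>I. x i ^ l) + of_nat l * g"
  using assms(2,3)
proof (induction I)
  case empty
  then show ?case using assms(1) prime_gt_0_nat[of l] by (intro bexI[of _ 0] zero_in_root_ring) simp
next
  case (insert j I)
  then obtain g where g: "g \<in> root_ring q" "(\<Sum>i\<in>I. x i) ^ l = (\<Sum>i\<in>I. x i ^ l) + of_nat l * g"
    by auto
  have "x j \<in> root_ring q" "(\<Sum>i\<in>I. x i) \<in> root_ring q"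
    using insert.prems by (auto intro: root_ring_sum)
  from add_power_prime[OF assms(1) this] obtain g' where g': "g' \<in> root_ring q"
    "(x j + (\<Sum>i\<in>I. x i)) ^ l = x j ^ l + (\<Sum>i\<in>I. x i) ^ l + of_nat l * g'" by blast
  show ?case using g g' insert.hyps
    by (intro bexI[of _ "g + g'"] root_ring.add) (simp_all add: algebra_simps)
qed

section \<open>Divisibility in the ring of roots of unity\<close>

interpretation rat_vs: vector_space "\<lambda>(r::rat) (z::complex). of_rat r * z"
  by unfold_locales (simp_all add: algebra_simps of_rat_add of_rat_mult)

text \<open>The coordinate along \<open>w\<close> in a basis of the complex numbers over the
  rationals that contains \<open>w\<close>.\<close>

lemma rational_functional:
  fixes w :: complex
  assumes "w \<noteq> 0"
  obtains \<phi> :: "complex \<Rightarrow> rat" where "\<And>x y. \<phi> (x + y) = \<phi> x + \<phi> y" "\<phi> w = 1"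
proof
  define B where "B = rat_vs.extend_basis {w}"
  have ind: "rat_vs.independent {w}"
    using assms by (simp add: rat_vs.dependent_single)
  note B = rat_vs.independent_extend_basis[OF ind] rat_vs.span_extend_basis[OF ind]
    rat_vs.extend_basis_superset[OF ind]
  show "rat_vs.representation B (x + y) w = rat_vs.representation B x w + rat_vs.representation B y w" for x y
    using B by (simp add: B_def rat_vs.representation_add)
  show "rat_vs.representation B w w = 1"
    using B rat_vs.representation_basis[of B w] by (auto simp: B_def)
qed

lemma common_denominator:
  fixes S :: "rat set"
  assumes "finite S"
  shows "\<exists>D::nat>0. \<forall>r\<in>S. of_nat D * r \<in> \<int>"
  using assms
proof induction
  case empty
  then show ?case by auto
next
  case (insert r S)
  then obtain D :: nat where D: "D > 0" "\<forall>r\<in>S. of_nat D * r \<in> \<int>" by auto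
  obtain a b where r: "r = Fract a b" "b > 0" by (cases r) auto
  have "of_nat (nat b * D) * r = of_int (int D * a)"
    using r by (simp add: Fract_of_int_quotient)
  moreover have "of_nat (nat b * D) * s \<in> \<int>" if "s \<in> S" for s
    using Ints_mult[of "of_nat (nat b)" "of_nat D * s"] D(2) that by (simp add: mult.assoc)
  ultimately show ?case using D(1) r(2)
    by (intro exI[of _ "nat b * D"]) (auto simp del: of_int_mult of_nat_mult)
qed

text \<open>An additive \<phi> with \<open>\<phi> w = 1\<close> maps the finitely many roots, hence
  all of \<open>root_ring q\<close>, to rationals with one common denominator \<open>D\<close>. If
  \<open>w\<close> is \<open>l\<close> times a ring element, then \<open>l\<close> divides
  \<open>D\<close>.\<close>

lemma root_ring_not_infinitely_divisible:
  assumes "q > 0" "w \<noteq> 0"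
  shows "\<exists>L. \<forall>l>L. \<forall>g\<in>root_ring q. w \<noteq> of_nat l * g"
proof -
  obtain \<phi> :: "complex \<Rightarrow> rat" where \<phi>: "\<And>x y. \<phi> (x + y) = \<phi> x + \<phi> y" "\<phi> w = 1"
    using rational_functional[OF assms(2)] by blast
  interpret additive \<phi> by unfold_locales (rule \<phi>(1))
  have mult: "\<phi> (of_nat n * x) = of_nat n * \<phi> x" for n x
    by (induction n) (simp_all add: zero add algebra_simps)
  obtain D :: nat where D: "D > 0" "\<forall>z. z ^ q = 1 \<longrightarrow> of_nat D * \<phi> z \<in> \<int>"
    using common_denominator[OF finite_imageI[OF finite_roots_unity], of q \<phi>] assms(1) by auto
  have int: "of_nat D * \<phi> g \<in> \<int>" if "g \<in> root_ring q" for g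
    using that by induction (auto simp: D(2) add minus ring_distribs)
  show ?thesis
  proof (intro exI[of _ D] allI impI ballI notI)
    fix l g assume l: "D < l" "g \<in> root_ring q" "w = of_nat l * g"
    obtain m where m: "of_nat D * \<phi> g = of_int m" using int[OF l(2)] by (auto elim: Ints_cases)
    have "(of_nat D :: rat) = of_nat D * (of_nat l * \<phi> g)" using \<phi>(2) l(3) mult by simp
    also have "\<dots> = of_int (int l * m)" using m by (simp add: mult.left_commute)
    finally have "int D = int l * m" by (metis of_int_eq_iff of_int_of_nat_eq)
    then have "int l dvd int D" by simp
    then show False using l(1) D(1) by (auto dest: dvd_imp_le)
  qed
qed

text \<open>An elementary substitute for Dirichlet's theorem: with \<open>?N\<close> the product of
  the primes up to \<open>L\<close> that do not divide \<open>t\<close>, each prime up to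
  \<open>L\<close> divides exactly one of \<open>t\<close> and \<open>q * ?N\<close>, hence not
  their sum.\<close>

lemma coprime_large_prime_factors:
  fixes t q L :: nat
  assumes "coprime t q" "q > 0"
  obtains n where "n mod q = t mod q" "n > 0" "\<And>p. prime p \<Longrightarrow> p dvd n \<Longrightarrow> p > L"
proof
  let ?P = "{p. prime p \<and> p \<le> L \<and> \<not> p dvd t}"
  let ?N = "\<Prod>?P"
  have fin: "finite ?P" by (rule finite_subset[of _ "{..L}"]) auto
  have N: "?N > 0" using fin by (intro prod_pos) (auto simp: prime_gt_0_nat)
  show "(t + q * ?N) mod q = t mod q" by simp
  show "t + q * ?N > 0" using N assms(2) by simp
  fix p assume p: "prime p" "p dvd t + q * ?N"
  show "p > L"
  proof (rule ccontr)
    assume "\<not> p > L"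
    show False
    proof (cases "p dvd t")
      case True
      then have "p dvd q * ?N" using p(2) by (simp add: dvd_add_right_iff)
      moreover have "\<not> p dvd q" using True assms(1) p(1)
        by (meson coprime_common_divisor not_prime_unit)
      ultimately have "p dvd ?N" using p(1) by (simp add: prime_dvd_mult_iff)
      then obtain p' where "p' \<in> ?P" "p dvd p'" using fin p(1) by (auto simp: prime_dvd_prod_iff)
      then show False using True p(1) primes_dvd_imp_eq[of p p'] by auto
    next
      case False
      then have "p \<in> ?P" using p(1) \<open>\<not> p > L\<close> by simp
      then have "p dvd ?N" using fin by (rule dvd_prodI[rotated])
      then show False using False p(2) by (simp add: dvd_add_left_iff)
    qed
  qed
qed

text \<open>
  Irreducibility of the cyclotomic polynomial in disguise. For a large prime \<open>l\<close>, the number \<open>\<Sum> x\<^sub>i^l\<close>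
  is divisible by \<open>l\<close> because \<open>\<Sum> x\<^sub>i = 0\<close>, hence it vanishes. Every residue class coprime to \<open>q\<close>
  contains a product of such primes.
\<close>

theorem sum_roots_of_unity_galois:
  fixes x :: "'i \<Rightarrow> complex"
  assumes fin: "finite I" and q: "q > 0" and x: "\<And>i. i \<in> I \<Longrightarrow> x i ^ q = 1"
    and sum: "(\<Sum>i\<in>I. x i) = 0" and t: "coprime t q"
  shows "(\<Sum>i\<in>I. x i ^ t) = 0"
proof -
  define W where "W s = (\<Sum>i\<in>I. x i ^ s)" for s
  have W_mod: "W s = W s'" if "s mod q = s' mod q" for s s'
    unfolding W_def
  proof (rule sum.cong)
    fix i assume "i \<in> I"
    have "x i ^ s = x i ^ (s mod q)" for s
      using power_add[of "x i" "q * (s div q)" "s mod q"] x[OF \<open>i \<in> I\<close>] by (simp add: power_mult)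
    then show "x i ^ s = x i ^ s'" using that by metis
  qed simp
  have "\<forall>s. \<exists>L. W s \<noteq> 0 \<longrightarrow> (\<forall>l>L. \<forall>g\<in>root_ring q. W s \<noteq> of_nat l * g)"
    using root_ring_not_infinitely_divisible[OF q] by blast
  then obtain L where L: "\<And>s l g. W s \<noteq> 0 \<Longrightarrow> l > L s \<Longrightarrow> g \<in> root_ring q \<Longrightarrow> W s \<noteq> of_nat l * g"
    by metis
  \<comment> \<open>\<open>W\<close> depends only on the exponent modulo \<open>q\<close>, so
    finitely many bounds \<open>L s\<close> matter and \<open>M\<close> dominates them all.\<close>
  define M where "M = Max (L ` {..<q})"
  have M: "L (s mod q) \<le> M" for s unfolding M_def using q by (intro Max_ge) auto
  have step: "W (s * l) = 0" if l: "prime l" "l > M" and s: "W s = 0" for s l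
  proof -
    have "\<And>i. i \<in> I \<Longrightarrow> x i ^ s \<in> root_ring q"
      using x by (intro root_ring_power root_ring.root)
    from sum_power_prime[OF l(1) fin, of "\<lambda>i. x i ^ s" q, OF this] obtain g where g: "g \<in> root_ring q"
      "W s ^ l = W (s * l) + of_nat l * g"
      unfolding W_def by (auto simp: power_mult)
    then have "W (s * l mod q) = of_nat l * (- g)"
      using s l(1) prime_gt_0_nat[of l] W_mod[of "s * l mod q" "s * l"] by (auto simp add: eq_neg_iff_add_eq_0 zero_power)
    then have "W (s * l mod q) = 0"
      using L[of "s * l mod q" l "- g"] M[of "s * l"] l(2) root_ring.minus[OF g(1)] by fastforce
    then show ?thesis using W_mod[of "s * l mod q" "s * l"] by simp
  qed
  obtain n where n: "n mod q = t mod q" "n > 0" "\<And>p. prime p \<Longrightarrow> p dvd n \<Longrightarrow> p > M"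
    using coprime_large_prime_factors[OF t q] by blast
  have "(\<forall>p. prime p \<longrightarrow> p dvd n \<longrightarrow> p > M) \<longrightarrow> W n = 0"
    using n(2)
  proof (induction n rule: prime_divisors_induct)
    case (factor p n)
    then show ?case using step[of p n] by (auto simp: mult.commute)
  qed (use sum in \<open>auto simp: W_def\<close>)
  then show ?thesis using n W_mod[of n t] by (simp add: W_def)
qed

text \<open>
  With \<open>m = q div p\<close>, the Galois conjugate \<open>x \<mapsto> x^(1 + m v)\<close> multiplies \<open>x\<close> by \<open>(x^m)^v\<close>. It is available unless
  \<open>p\<close> divides \<open>1 + m v\<close>, which happens for at most one \<open>v = v0\<close> modulo \<open>p\<close>, so Fourier inversion in \<open>v\<close>
  determines the partial sums over the classes \<open>x^m = e\<close> up to a common factor \<open>W\<close>.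
\<close>

lemma class_sums:
  fixes x :: "'i \<Rightarrow> complex"
  assumes fin: "finite I" and q: "q > 0" and x: "\<And>i. i \<in> I \<Longrightarrow> x i ^ q = 1"
    and sum: "(\<Sum>i\<in>I. x i) = 0" and p: "prime p" "p dvd q"
  obtains W :: complex and v0 :: nat where
    "\<And>e. e ^ p = 1 \<Longrightarrow> of_nat p * (\<Sum>i | i \<in> I \<and> x i ^ (q div p) = e. x i) * e ^ v0 = W"
    "p dvd q div p \<Longrightarrow> W = 0"
proof -
  define m where "m = q div p"
  have qm: "q = p * m" using p by (simp add: m_def)
  have p0: "p > 0" using p(1) by (rule prime_gt_0_nat)
  define T where "T v = (\<Sum>i\<in>I. x i * (x i ^ m) ^ v)" for v
  have T0: "T v = 0" if "\<not> p dvd 1 + m * v" for v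
  proof -
    have "gcd m (v * m + 1) = 1" by (simp only: gcd_add_mult) simp
    then have "coprime (1 + m * v) m"
      by (simp add: coprime_iff_gcd_eq_1 gcd.commute mult.commute)
    moreover have "coprime (1 + m * v) p" using p(1) that by (metis coprime_commute prime_imp_coprime)
    ultimately have "coprime (1 + m * v) q" unfolding qm by simp
    from sum_roots_of_unity_galois[OF fin q x sum this] show ?thesis
      by (simp add: T_def power_add power_mult)
  qed
  have fourier: "of_nat p * (\<Sum>i | i \<in> I \<and> x i ^ m = e. x i) = (\<Sum>v<p. T v * inverse e ^ v)" if e: "e ^ p = 1" for e
  proof -
    have "e \<noteq> 0" using e p0 by (auto simp: power_0_left)
    have geom: "(\<Sum>v<p. (x i ^ m * inverse e) ^ v) = (if x i ^ m = e then of_nat p else 0)" if "i \<in> I" for i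
    proof (cases "x i ^ m = e")
      case True
      then show ?thesis using \<open>e \<noteq> 0\<close> by simp
    next
      case False
      then have "x i ^ m * inverse e \<noteq> 1" using \<open>e \<noteq> 0\<close> by (auto simp: field_simps)
      moreover have "(x i ^ m * inverse e) ^ p = 1"
        using x[OF that] e by (simp add: power_mult_distrib power_inverse qm mult.commute flip: power_mult)
      ultimately show ?thesis using False by (simp add: geometric_sum)
    qed
    have "(\<Sum>v<p. T v * inverse e ^ v) = (\<Sum>v<p. \<Sum>i\<in>I. x i * (x i ^ m * inverse e) ^ v)"
      by (simp add: T_def sum_distrib_right power_mult_distrib mult.assoc)
    also have "\<dots> = (\<Sum>i\<in>I. x i * (\<Sum>v<p. (x i ^ m * inverse e) ^ v))"
      by (subst sum.swap) (simp add: sum_distrib_left)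
    also have "\<dots> = (\<Sum>i\<in>I. if x i ^ m = e then of_nat p * x i else 0)"
      by (intro sum.cong refl) (simp only: geom, simp)
    also have "\<dots> = (\<Sum>i | i \<in> I \<and> x i ^ m = e. of_nat p * x i)"
      using fin by (simp add: sum.inter_filter)
    finally show ?thesis by (simp add: sum_distrib_left)
  qed
  \<comment> \<open>If every conjugate is available, all \<open>T v\<close> vanish and
    \<open>W = 0\<close> works; otherwise only the term \<open>v0\<close> survives, and
    \<open>p\<close> does not divide \<open>m\<close>.\<close>
  show thesis
  proof (cases "\<exists>v<p. p dvd 1 + m * v")
    case False
    then have "of_nat p * (\<Sum>i | i \<in> I \<and> x i ^ m = e. x i) = 0" if "e ^ p = 1" for e
      unfolding fourier[OF that] using T0 by (intro sum.neutral) auto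
    then show thesis using that[of 0 0] by (simp add: m_def)
  next
    case True
    then obtain v0 where v0: "v0 < p" "p dvd 1 + m * v0" by blast
    have unique: "v = v0" if "v < p" "p dvd 1 + m * v" for v
    proof -
      have ndvd: "\<not> p dvd m" using v0(2) p(1)
        by (metis dvd_add_left_iff dvd_mult2 nat_dvd_1_iff_1 not_prime_1)
      have "int p dvd int (1 + m * v) - int (1 + m * v0)"
        using that(2) v0(2) by (intro dvd_diff) (simp_all only: int_dvd_int_iff)
      also have "int (1 + m * v) - int (1 + m * v0) = int m * (int v - int v0)"
        by (simp add: algebra_simps)
      finally have "int p dvd int v - int v0"
        using ndvd p(1) by (simp add: prime_dvd_mult_iff)
      then show ?thesis
        using that(1) v0(1) zdvd_not_zless[of "int v - int v0" "int p"] zdvd_not_zless[of "int v0 - int v" "int p"]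
        by (cases v v0 rule: linorder_cases) (simp_all add: dvd_diff_commute)
    qed
    have "of_nat p * (\<Sum>i | i \<in> I \<and> x i ^ m = e. x i) * e ^ v0 = T v0" if e: "e ^ p = 1" for e
    proof -
      have "e \<noteq> 0" using e p0 by (auto simp: power_0_left)
      have "(\<Sum>v<p. T v * inverse e ^ v) = (\<Sum>v\<in>{v0}. T v * inverse e ^ v)"
        using v0(1) unique T0 by (intro sum.mono_neutral_right) auto
      then show ?thesis using fourier[OF e] \<open>e \<noteq> 0\<close> by (simp add: power_inverse)
    qed
    moreover have "\<not> p dvd m" using v0(2) p(1)
      by (metis dvd_add_left_iff dvd_mult2 nat_dvd_1_iff_1 not_prime_1)
    ultimately show thesis using that[of v0 "T v0"] by (simp add: m_def)
  qed
qed

text \<open>The hypothesis says that \<open>q\<close> is squarefree with prime factors among 2, 3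
  and 5, whose product is 30.\<close>

lemma dvd_30I:
  fixes q :: nat
  assumes "q > 0" and p: "\<And>p. prime p \<Longrightarrow> p dvd q \<Longrightarrow> p < 7 \<and> \<not> p dvd q div p"
  shows "q dvd 30"
proof (rule multiplicity_le_imp_dvd)
  show "q \<noteq> 0" using assms(1) by simp
  fix p :: nat assume "prime p"
  show "multiplicity p q \<le> multiplicity p 30"
  proof (cases "p dvd q")
    case True
    have "\<not> p ^ 2 dvd q"
    proof
      assume "p ^ 2 dvd q"
      then obtain k where "q = p ^ 2 * k" by (elim dvdE)
      then have "q div p = p * k"
        using \<open>prime p\<close> by (simp add: power2_eq_square prime_gt_0_nat mult.assoc)
      then show False using p[OF \<open>prime p\<close> True] by simp
    qed
    then have "multiplicity p q < 2"
      using assms(1) \<open>prime p\<close> by (meson linorder_not_less multiplicity_dvd' power_dvd_iff_le_multiplicity)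
    moreover have "p < 7" using p[OF \<open>prime p\<close> True] by simp
    then have "p = 0 \<or> p = 1 \<or> p = 2 \<or> p = 3 \<or> p = 4 \<or> p = 5 \<or> p = 6" by linarith
    then have "p dvd 30" using \<open>prime p\<close> prime_product[of 2 2] prime_product[of 2 3] by auto
    then have "multiplicity p 30 \<ge> 1"
      using \<open>prime p\<close> by (intro multiplicity_geI) (auto simp: not_prime_unit)
    ultimately show ?thesis by simp
  qed (simp add: not_dvd_imp_multiplicity_0)
qed

section \<open>Solving the system\<close>

text \<open>Doubled cosines, and in \<open>b0\<close> doubled sines, of a numerical solution of the
  system.\<close>

definition a0 :: "nat \<Rightarrow> real" where
  "a0 j = [-1844914, -142842, -1240610, 1995650, 232717] ! j / 10^6"

definition b0 :: "nat \<Rightarrow> real" where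
  "b0 j = [-772199, -1994892, 1568722, -131840, -1986415] ! j / 10^6"

text \<open>The circle equations, the sum of the cosines, and for index distances 1 and 2 the
  suitably scaled sum and difference of the equations for angle sums and angle differences, which
  separate cosines from sines. The double-angle equation follows by
  \<open>residual_square_sum\<close>.\<close>

definition residual :: "(nat \<Rightarrow> real) \<Rightarrow> (nat \<Rightarrow> real) \<Rightarrow> nat \<Rightarrow> real" where
  "residual a b k = [
     (a 0)\<^sup>2 + (b 0)\<^sup>2 - 4,
     (a 1)\<^sup>2 + (b 1)\<^sup>2 - 4,
     (a 2)\<^sup>2 + (b 2)\<^sup>2 - 4,
     (a 3)\<^sup>2 + (b 3)\<^sup>2 - 4,
     (a 4)\<^sup>2 + (b 4)\<^sup>2 - 4,
     a 0 + a 1 + a 2 + a 3 + a 4 + 1,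
     a 0 * a 1 + a 1 * a 2 + a 2 * a 3 + a 3 * a 4 + a 4 * a 0 + 2,
     b 0 * b 1 + b 1 * b 2 + b 2 * b 3 + b 3 * b 4 + b 4 * b 0,
     a 0 * a 2 + a 1 * a 3 + a 2 * a 4 + a 3 * a 0 + a 4 * a 1 + 2,
     b 0 * b 2 + b 1 * b 3 + b 2 * b 4 + b 3 * b 0 + b 4 * b 1] ! k"

text \<open>The inverse Jacobian of \<open>residual\<close> at \<open>(a0, b0)\<close>, multiplied by 1000 and rounded.\<close>

definition newton_mat :: "nat \<Rightarrow> nat \<Rightarrow> real" where
  "newton_mat i k = [
     [-235, 25, 44, 27, -18, 82, 68, 85, 61, -15],
     [154, -14, -35, 39, 13, 366, -11, -58, 267, 5],
     [272, -18, -79, 236, 25, 585, 546, -108, 491, -6],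
     [-16, 12, -21, 237, 3, -36, -33, -2, -29, -22],
     [-175, -4, 90, -538, -23, 3, -569, 82, -790, 39],
     [-87, -60, -106, -64, 43, -196, -162, -204, -145, 37],
     [-11, -250, 2, -3, -1, -26, 1, 4, -19, 0],
     [215, -14, 257, 186, 20, 463, 432, -85, 388, -5],
     [-248, 174, -314, -207, 42, -543, -505, -26, -433, -338],
     [-20, -1, 11, -63, -254, 0, -67, 10, -93, 5]
     ] ! i ! k"

definition newton_inv :: "nat \<Rightarrow> (nat \<Rightarrow> real) \<Rightarrow> real" where
  "newton_inv i u = (\<Sum>k<10. newton_mat i k * u k) / 1000"

lemma sum_lt5: "(\<Sum>k<5. f k) = f 0 + f 1 + f 2 + f 3 + f (4::nat)"
  by (simp add: eval_nat_numeral)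

lemma sum_lt10: "(\<Sum>k<10. f k) = f 0 + f 1 + f 2 + f 3 + f 4 + f 5 + f 6 + f 7 + f 8 + f (9::nat)"
  by (simp add: eval_nat_numeral)

lemma all_lt5: "(\<forall>k<5. P k) \<longleftrightarrow> P 0 \<and> P 1 \<and> P 2 \<and> P 3 \<and> P (4::nat)"
  by (simp add: eval_nat_numeral All_less_Suc2)

lemma all_lt10: "(\<forall>k<10. P k) \<longleftrightarrow>
    P 0 \<and> P 1 \<and> P 2 \<and> P 3 \<and> P 4 \<and> P 5 \<and> P 6 \<and> P 7 \<and> P 8 \<and> P (9::nat)"
  by (simp add: eval_nat_numeral All_less_Suc2)

lemma sum_lt11: "(\<Sum>k<11. f k) = f 0 + f 1 + f 2 + f 3 + f 4 + f 5 + f 6 + f 7 + f 8 + f 9 + f (10::nat)"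
  by (simp add: eval_nat_numeral)

lemma all_lt11: "(\<forall>k<11. P k) \<longleftrightarrow>
    P 0 \<and> P 1 \<and> P 2 \<and> P 3 \<and> P 4 \<and> P 5 \<and> P 6 \<and> P 7 \<and> P 8 \<and> P 9 \<and> P (10::nat)"
  by (simp add: eval_nat_numeral All_less_Suc2)

text \<open>Each row of \<open>newton_mat\<close> has absolute sum at most 3000, and
  \<open>3000/1000 * 3/100000\<close> is below 1/10000.\<close>

lemma newton_inv_bound:
  assumes "\<forall>k<10. \<bar>u k\<bar> \<le> 3/100000"
  shows "\<forall>i<10. \<bar>newton_inv i u\<bar> \<le> 1/10000"
proof (intro allI impI)
  fix i :: nat assume "i < 10"
  have "\<forall>i<10. (\<Sum>k<10. \<bar>newton_mat i k\<bar>) \<le> 3000"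
    unfolding all_lt10 sum_lt10 newton_mat_def by simp
  then have row: "(\<Sum>k<10. \<bar>newton_mat i k\<bar>) \<le> 3000" using \<open>i < 10\<close> by blast
  have "\<bar>\<Sum>k<10. newton_mat i k * u k\<bar> \<le> (\<Sum>k<10. \<bar>newton_mat i k\<bar> * (3/100000))"
    using assms by (intro order_trans[OF sum_abs] sum_mono) (simp only: abs_mult lessThan_iff mult_left_mono abs_ge_zero)
  also have "\<dots> \<le> 1/10"
    unfolding sum_distrib_right[symmetric] using row by simp
  finally show "\<bar>newton_inv i u\<bar> \<le> 1/10000" by (simp add: newton_inv_def)
qed

lemma residual_cong:
  assumes "\<And>j. j < 5 \<Longrightarrow> a j = a' j \<and> b j = b' j"
  shows "residual a b k = residual a' b' k"
  unfolding residual_def using assms[of 0] assms[of 1] assms[of 2] assms[of 3] assms[of 4]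
  by (simp only:)

text \<open>The residual at \<open>(a0, b0)\<close> is tiny, the rounded inverse Jacobian makes the
  linear part close to the identity, and the quadratic remainder consists of products of size
  1/10^8. The unknown \<open>u\<close> lives in the space of residuals, so the preconditioner acts
  on the right.\<close>

lemma newton_step:
  assumes u: "\<forall>k<10. \<bar>u k\<bar> \<le> 3/100000"
  shows "\<forall>k<10. \<bar>u k - residual (\<lambda>j. a0 j + newton_inv j u) (\<lambda>j. b0 j + newton_inv (5 + j) u) k\<bar> \<le> 3/100000"
proof -
  \<comment> \<open>The default 0 beyond index 9 makes the bound hold for every index.\<close>
  define h where "h i = (if i < 10 then newton_inv i u else 0)" for i
  have h_eq: "\<forall>i<10. h i = newton_inv i u"
    by (simp add: h_def)
  have "\<bar>h i\<bar> \<le> 1/10000" for i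
    using newton_inv_bound[OF u] by (simp add: h_def)
  note h_mult = mult_mono[OF this this]
  \<comment> \<open>Naming the quadratic monomials turns the ten inequalities into linear
    ones.\<close>
  define p where "p i j = h i * h j" for i j
  have "\<bar>p i j\<bar> \<le> 1/100000000" for i j
    using h_mult[of i j] by (simp add: p_def abs_mult mult.commute)
  then have p: "p i j \<le> 1/100000000 \<and> - p i j \<le> 1/100000000" for i j
    by (simp only: abs_le_iff)
  note h_lin = h_eq[unfolded all_lt10 newton_inv_def sum_lt10 newton_mat_def]
  note u_le = u[unfolded all_lt10 abs_le_iff]
  let ?r = "\<lambda>k. \<bar>u k - residual (\<lambda>j. a0 j + h j) (\<lambda>j. b0 j + h (5 + j)) k\<bar> \<le> 3/100000"
  note expand = residual_def a0_def b0_def power2_eq_square algebra_simps p_def[symmetric]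
  note collect = add_divide_distrib diff_divide_distrib
  have "?r 0"
    unfolding abs_le_iff
    by (simp add: expand del: One_nat_def, simp only: h_lin, simp add: collect del: One_nat_def)
      (insert u_le p[of 0 0] p[of 5 5], elim conjE, intro conjI; linarith)
  moreover have "?r 1"
    unfolding abs_le_iff
    by (simp add: expand del: One_nat_def, simp only: h_lin, simp add: collect del: One_nat_def)
      (insert u_le p[of 1 1] p[of 6 6], elim conjE, intro conjI; linarith)
  moreover have "?r 2"
    unfolding abs_le_iff
    by (simp add: expand del: One_nat_def, simp only: h_lin, simp add: collect del: One_nat_def)
      (insert u_le p[of 2 2] p[of 7 7], elim conjE, intro conjI; linarith)
  moreover have "?r 3"
    unfolding abs_le_iff
    by (simp add: expand del: One_nat_def, simp only: h_lin, simp add: collect del: One_nat_def)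
      (insert u_le p[of 3 3] p[of 8 8], elim conjE, intro conjI; linarith)
  moreover have "?r 4"
    unfolding abs_le_iff
    by (simp add: expand del: One_nat_def, simp only: h_lin, simp add: collect del: One_nat_def)
      (insert u_le p[of 4 4] p[of 9 9], elim conjE, intro conjI; linarith)
  moreover have "?r 5"
    unfolding abs_le_iff
    by (simp add: expand del: One_nat_def, simp only: h_lin, simp add: collect del: One_nat_def)
      (insert u_le, elim conjE, intro conjI; linarith)
  moreover have "?r 6"
    unfolding abs_le_iff
    by (simp add: expand del: One_nat_def, simp only: h_lin, simp add: collect del: One_nat_def)
      (insert u_le p[of 1 0] p[of 0 4] p[of 1 2] p[of 2 3] p[of 3 4], elim conjE, intro conjI; linarith)
  moreover have "?r 7"
    unfolding abs_le_iff
    by (simp add: expand del: One_nat_def, simp only: h_lin, simp add: collect del: One_nat_def)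
      (insert u_le p[of 6 5] p[of 5 9] p[of 6 7] p[of 7 8] p[of 8 9], elim conjE, intro conjI; linarith)
  moreover have "?r 8"
    unfolding abs_le_iff
    by (simp add: expand del: One_nat_def, simp only: h_lin, simp add: collect del: One_nat_def)
      (insert u_le p[of 0 2] p[of 0 3] p[of 1 3] p[of 1 4] p[of 2 4], elim conjE, intro conjI; linarith)
  moreover have "?r 9"
    unfolding abs_le_iff
    by (simp add: expand del: One_nat_def, simp only: h_lin, simp add: collect del: One_nat_def)
      (insert u_le p[of 5 7] p[of 5 8] p[of 6 8] p[of 6 9] p[of 7 9], elim conjE, intro conjI; linarith)
  ultimately have "\<forall>k<10. ?r k"
    unfolding all_lt10 by (intro conjI)
  moreover have "residual (\<lambda>j. a0 j + h j) (\<lambda>j. b0 j + h (5 + j)) =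
      residual (\<lambda>j. a0 j + newton_inv j u) (\<lambda>j. b0 j + newton_inv (5 + j) u)"
    by (intro ext residual_cong) (simp add: h_def)
  ultimately show ?thesis by (simp only:)
qed

section \<open>Existence of an exact solution\<close>

lemma brouwer_cube_zero:
  fixes F :: "real^'n \<Rightarrow> real^'n" and s :: real
  assumes "continuous_on UNIV F" and "s \<ge> 0"
    and step: "\<And>x k. (\<And>i. \<bar>x $ i\<bar> \<le> s) \<Longrightarrow> \<bar>x $ k - F x $ k\<bar> \<le> s"
  shows "\<exists>x. (\<forall>i. \<bar>x $ i\<bar> \<le> s) \<and> F x = 0"
proof -
  define S :: "(real^'n) set" where "S = cbox (\<chi> i. - s) (\<chi> i. s)"
  have S: "x \<in> S \<longleftrightarrow> (\<forall>i. \<bar>x $ i\<bar> \<le> s)" for x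
    by (auto simp: S_def mem_box_cart abs_le_iff minus_le_iff)
  \<comment> \<open>A fixed point of \<open>x - F x\<close> is a zero of \<open>F\<close>, and
    \<open>step\<close> says that the cube is preserved.\<close>
  obtain x where "x \<in> S" "x - F x = x"
  proof (rule brouwer[of S "\<lambda>x. x - F x"])
    show "compact S" "convex S" by (auto simp: S_def)
    show "S \<noteq> {}" using S[of 0] \<open>s \<ge> 0\<close> by auto
    show "continuous_on S (\<lambda>x. x - F x)"
      using assms(1) by (intro continuous_intros) (auto intro: continuous_on_subset)
    show "(\<lambda>x. x - F x) \<in> S \<rightarrow> S"
      using step by (auto simp: S)
  qed
  then show ?thesis using S by auto
qed

definition fin10 :: "10 \<Rightarrow> nat" where "fin10 r = nat (Rep_bit0 r)"

lemma fin10_of_nat: "m < 10 \<Longrightarrow> fin10 (of_nat m) = m"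
  using bit0.Abs_inverse[where 'a=5, of "int m"] by (simp add: fin10_def bit0.of_nat_eq)

lemma fin10_less: "fin10 r < 10"
  using bit0.Rep_less_n[of r] by (simp add: fin10_def)

lemma continuous_on_residual:
  assumes "\<And>j. continuous_on S (\<lambda>x. a x j)" "\<And>j. continuous_on S (\<lambda>x. b x j)"
  shows "k < 10 \<Longrightarrow> continuous_on S (\<lambda>x. residual (a x) (b x) k)"
proof -
  have "\<forall>k<10. continuous_on S (\<lambda>x. residual (a x) (b x) k)"
    unfolding all_lt10 residual_def by (simp, intro conjI continuous_intros assms)
  then show "k < 10 \<Longrightarrow> continuous_on S (\<lambda>x. residual (a x) (b x) k)" by blast
qed

theorem exists_solution:
  "\<exists>a b. (\<forall>j<5. \<bar>a j - a0 j\<bar> \<le> 1/10000 \<and> \<bar>b j - b0 j\<bar> \<le> 1/10000) \<and> (\<forall>k<10. residual a b k = 0)"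
proof -
  define e :: "real^10 \<Rightarrow> nat \<Rightarrow> real" where "e v k = v $ of_nat k" for v k
  define A where "A v j = a0 j + newton_inv j (e v)" for v j
  define B where "B v j = b0 j + newton_inv (5 + j) (e v)" for v j
  define F :: "real^10 \<Rightarrow> real^10" where "F v = (\<chi> k. residual (A v) (B v) (fin10 k))" for v
  have "continuous_on UNIV F"
    unfolding F_def A_def B_def newton_inv_def e_def
    by (intro continuous_on_vec_lambda continuous_on_residual continuous_intros fin10_less) auto
  moreover have "\<bar>v $ k - F v $ k\<bar> \<le> 3/100000" if "\<And>i. \<bar>v $ i\<bar> \<le> 3/100000" for v k
  proof -
    have "\<forall>k<10. \<bar>e v k\<bar> \<le> 3/100000" using that by (simp add: e_def)
    from newton_step[OF this] fin10_less[of k]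
    have "\<bar>e v (fin10 k) - residual (A v) (B v) (fin10 k)\<bar> \<le> 3/100000"
      unfolding A_def B_def by blast
    moreover have "of_nat (fin10 k) = k"
      using Rep_bit0[of k] by (simp add: fin10_def bit0.of_nat_eq Rep_bit0_inverse)
    ultimately show ?thesis by (simp add: F_def e_def)
  qed
  ultimately obtain v where v: "\<forall>i. \<bar>v $ i\<bar> \<le> 3/100000" and "F v = 0"
    using brouwer_cube_zero[of F "3/100000"] by auto
  have "\<forall>k<10. \<bar>e v k\<bar> \<le> 3/100000" using v by (simp add: e_def)
  from newton_inv_bound[OF this] have "\<forall>j<5. \<bar>A v j - a0 j\<bar> \<le> 1/10000 \<and> \<bar>B v j - b0 j\<bar> \<le> 1/10000"
    by (simp add: A_def B_def)
  moreover have "residual (A v) (B v) k = 0" if "k < 10" for k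
    using arg_cong[OF \<open>F v = 0\<close>, of "\<lambda>x. x $ of_nat k"] that by (simp add: F_def fin10_of_nat)
  ultimately show ?thesis by blast
qed

text \<open>The first five residuals put \<open>(a j / 2, b j / 2)\<close> on the unit
  circle.\<close>

lemma exists_angles:
  "\<exists>\<alpha>. (\<forall>j<5. \<bar>2 * cos (\<alpha> j) - a0 j\<bar> \<le> 1/10000 \<and> \<bar>2 * sin (\<alpha> j) - b0 j\<bar> \<le> 1/10000) \<and>
    (\<forall>k<10. residual (\<lambda>j. 2 * cos (\<alpha> j)) (\<lambda>j. 2 * sin (\<alpha> j)) k = 0)"
proof -
  obtain a b where ab: "\<forall>j<5. \<bar>a j - a0 j\<bar> \<le> 1/10000 \<and> \<bar>b j - b0 j\<bar> \<le> 1/10000"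
    and res: "\<forall>k<10. residual a b k = 0"
    using exists_solution by blast
  have circle: "(a j)\<^sup>2 + (b j)\<^sup>2 = 4" if "j < 5" for j
  proof -
    have "\<forall>j<5. (a j)\<^sup>2 + (b j)\<^sup>2 = 4"
      using res unfolding all_lt10 all_lt5 by (simp add: residual_def)
    then show ?thesis using that by blast
  qed
  have "\<exists>t. 2 * cos t = a j \<and> 2 * sin t = b j" if "j < 5" for j
  proof -
    have "(a j / 2)\<^sup>2 + (b j / 2)\<^sup>2 = 1" using circle[OF that] by (simp add: power_divide)
    then obtain t where "a j / 2 = cos t" "b j / 2 = sin t"
      using sincos_total_2pi by metis
    then show ?thesis by (intro exI[of _ t]) simp
  qed
  then obtain \<alpha> where \<alpha>: "\<And>j. j < 5 \<Longrightarrow> 2 * cos (\<alpha> j) = a j \<and> 2 * sin (\<alpha> j) = b j" by metis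
  have "residual (\<lambda>j. 2 * cos (\<alpha> j)) (\<lambda>j. 2 * sin (\<alpha> j)) k = residual a b k" for k
    by (rule residual_cong) (rule \<alpha>)
  then show ?thesis using ab res \<alpha> by (intro exI[of _ \<alpha>]) simp
qed

section \<open>The matrix and its symmetries\<close>

text \<open>
  The entries of \<open>L11\<close> are named by the letters 0, \<open>2 j + 1\<close> and \<open>2 j + 2\<close>, which stand for \<open>1\<close>, \<open>c\<^sub>j\<close> and \<open>cnj c\<^sub>j\<close>.
\<close>

definition letter_index :: "nat \<Rightarrow> nat \<Rightarrow> nat" where
  "letter_index i k = (if i = 0 \<or> k = 0 then 0
     else 1 + 2 * (((k - 1) div 2 + 5 - (i - 1) div 2) mod 5) + (if (i - 1) mod 2 = (k - 1) mod 2 then 0 else 1))"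

definition letter :: "(nat \<Rightarrow> complex) \<Rightarrow> nat \<Rightarrow> complex" where
  "letter c n = (if n = 0 then 1 else if odd n then c (n div 2) else cnj (c (n div 2 - 1)))"

definition entry :: "(nat \<Rightarrow> complex) \<Rightarrow> nat \<Rightarrow> nat \<Rightarrow> complex" where
  "entry c i k = letter c (letter_index i k)"

lemma L11_entry: "L11 c $ r $ s = entry c (pos r) (pos s)"
proof -
  have "letter c (1 + 2 * m) = c m" "letter c (1 + 2 * m + 1) = cnj (c m)" for m
    by (simp_all add: letter_def)
  then show ?thesis
    by (simp only: L11_def entry_def letter_index_def core_L11_def C_block_def vec_lambda_beta add_0_right split: if_split)
      (simp add: letter_def)
qed

lemma sum_pos: "(\<Sum>r\<in>UNIV. f (pos r)) = (\<Sum>k<11. f k)"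
  using sum.reindex_bij_betw[OF bij_betw_pos] .

lemma letter_index_less: "letter_index i k < 11"
proof -
  have "2 * (m mod 5) \<le> 8" for m :: nat by presburger
  from this[of "(k - 1) div 2 + 5 - (i - 1) div 2"] show ?thesis
    unfolding letter_index_def by (simp split: if_split)
qed

lemma bij_betw_lt11I:
  fixes \<sigma> \<tau> :: "nat \<Rightarrow> nat"
  assumes "\<And>i. i < 11 \<Longrightarrow> \<sigma> i < 11" "\<And>i. i < (11::nat) \<Longrightarrow> \<tau> (\<sigma> i) = i"
  shows "bij_betw \<sigma> {..<11} {..<11}"
proof -
  have "inj_on \<sigma> {..<11}" using assms(2) by (metis inj_on_inverseI lessThan_iff)
  moreover have "\<sigma> ` {..<11} \<subseteq> {..<11}" using assms(1) by auto
  ultimately show ?thesis by (simp add: bij_betw_def endo_inj_surj)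
qed

text \<open>
  Applied to rows and columns simultaneously, \<open>shift\<close> and \<open>flip\<close> leave \<open>L11\<close> invariant; \<open>flip\<close> on the columns
  alone conjugates it.
\<close>

definition shift :: "nat \<Rightarrow> nat" where
  "shift i = (if i = 0 then 0 else (i + 1) mod 10 + 1)"

definition flip :: "nat \<Rightarrow> nat" where
  "flip i = (if i = 0 then 0 else if odd i then i + 1 else i - 1)"

lemma bij_shift: "bij_betw shift {..<11} {..<11}"
proof -
  \<comment> \<open>The inverse lowers 1, ..., 10 cyclically by 2: counted from 0 this is
    \<open>i - 1 + 8\<close> modulo 10.\<close>
  have "\<forall>i\<in>set [0..<11]. shift i < 11 \<and> (if shift i = 0 then 0 else (shift i + 7) mod 10 + 1) = i"
    by code_simp
  then show ?thesis
    by (intro bij_betw_lt11I[of _ "\<lambda>i. if i = 0 then 0 else (i + 7) mod 10 + 1"]) (simp_all only: set_upt atLeastLessThan_iff le0 simp_thms)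
qed

lemma flip_flip: "i < 11 \<Longrightarrow> flip i < 11 \<and> flip (flip i) = i"
proof -
  have "\<forall>i\<in>set [0..<11]. flip i < 11 \<and> flip (flip i) = i"
    by code_simp
  then show "i < 11 \<Longrightarrow> flip i < 11 \<and> flip (flip i) = i"
    by (simp only: set_upt atLeastLessThan_iff le0 simp_thms)
qed

lemma bij_flip: "bij_betw flip {..<11} {..<11}"
  by (rule bij_betw_lt11I[of _ flip]) (simp_all only: flip_flip)

text \<open>The equality holds already between letter indices, so a finite check settles it for
  every \<open>c\<close>.\<close>

lemma entry_shift: "i < 11 \<Longrightarrow> k < 11 \<Longrightarrow> entry c (shift i) (shift k) = entry c i k"
proof -
  have "\<forall>i\<in>set [0..<11]. \<forall>k\<in>set [0..<11]. letter_index (shift i) (shift k) = letter_index i k" by code_simp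
  then show "i < 11 \<Longrightarrow> k < 11 \<Longrightarrow> entry c (shift i) (shift k) = entry c i k" by (simp add: entry_def)
qed

lemma entry_flip: "i < 11 \<Longrightarrow> k < 11 \<Longrightarrow> entry c (flip i) (flip k) = entry c i k"
proof -
  have "\<forall>i\<in>set [0..<11]. \<forall>k\<in>set [0..<11]. letter_index (flip i) (flip k) = letter_index i k" by code_simp
  then show "i < 11 \<Longrightarrow> k < 11 \<Longrightarrow> entry c (flip i) (flip k) = entry c i k" by (simp add: entry_def)
qed

text \<open>Letters are numbered so that \<open>flip\<close> also exchanges \<open>c j\<close> with
  its conjugate and fixes the letter 0.\<close>

lemma letter_flip: "letter c (flip n) = cnj (letter c n)"
proof -
  have "(2 * b - Suc 0) div 2 = b - Suc 0" for b :: nat by (cases b) simp_all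
  then show ?thesis by (auto simp: letter_def flip_def elim!: oddE evenE)
qed

lemma entry_flip_col: "i < 11 \<Longrightarrow> k < 11 \<Longrightarrow> entry c i (flip k) = cnj (entry c i k)"
proof -
  have "\<forall>i\<in>set [0..<11]. \<forall>k\<in>set [0..<11]. letter_index i (flip k) = flip (letter_index i k)" by code_simp
  then show "i < 11 \<Longrightarrow> k < 11 \<Longrightarrow> entry c i (flip k) = cnj (entry c i k)" by (simp add: entry_def letter_flip)
qed

text \<open>\<open>flip\<close> takes row 1 to row 2, and \<open>shift\<close> takes each row
  \<open>p\<close> from 1 to 8 to row \<open>p + 2\<close>, so rows 0 and 1 suffice.\<close>

lemma all_shift_flip:
  assumes "P 0" "P 1" and flip: "P 1 \<Longrightarrow> P (2::nat)" and shift: "\<And>p. p \<in> {1..<9} \<Longrightarrow> P p \<Longrightarrow> P (p + 2)" and "p < 11"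
  shows "P p"
  using \<open>p < 11\<close>
proof (induction p rule: less_induct)
  case (less p)
  show ?case
  proof (cases "p \<le> 2")
    case True
    then have "p = 0 \<or> p = 1 \<or> p = 2" by linarith
    then show ?thesis using assms(1-3) by blast
  next
    case False
    with less.prems have "p - 2 \<in> {1..<9}" "p - 2 < p" "p - 2 < 11" "p - 2 + 2 = p" by auto
    then show ?thesis using shift[of "p - 2"] less.IH[of "p - 2"] by metis
  qed
qed

section \<open>The Hadamard property\<close>

lemma complex_hadamard_iff:
  fixes H :: "complex^11^11" and h :: "nat \<Rightarrow> nat \<Rightarrow> complex"
  assumes "\<And>r s. H $ r $ s = h (pos r) (pos s)"
  shows "complex_hadamard H \<longleftrightarrow> (\<forall>i<11. \<forall>k<11. cmod (h i k) = 1) \<and>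
    (\<forall>i<11. \<forall>j<11. (\<Sum>k<11. h i k * cnj (h j k)) = (if i = j then 11 else 0))"
proof -
  have all: "(\<forall>r. P (pos r)) \<longleftrightarrow> (\<forall>i<11. P i)" for P
  proof -
    have "range pos = {..<11}" using bij_betw_pos by (simp add: bij_betw_def)
    moreover have "(\<forall>r. P (pos r)) \<longleftrightarrow> (\<forall>i\<in>range pos. P i)" by blast
    ultimately show ?thesis by (simp only: Ball_def lessThan_iff)
  qed
  have eq: "pos r = pos s \<longleftrightarrow> r = s" for r s
    using bij_betw_pos by (auto simp: bij_betw_def inj_on_def)
  have "(H ** conj_transpose H) $ r $ s = (\<Sum>k<11. h (pos r) k * cnj (h (pos s) k))" for r s
    by (simp add: matrix_matrix_mult_def conj_transpose_def map_matrix_def transpose_def assms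
        sum_pos[of "\<lambda>k. h (pos r) k * cnj (h (pos s) k)", symmetric])
  moreover have "(real CARD(11) *\<^sub>R (mat 1 :: complex^11^11)) $ r $ s = (if pos r = pos s then 11 else 0)" for r s
    by (simp add: mat_def eq scaleR_conv_of_real)
  ultimately have "H ** conj_transpose H = real CARD(11) *\<^sub>R mat 1 \<longleftrightarrow>
      (\<forall>r s. (\<Sum>k<11. h (pos r) k * cnj (h (pos s) k)) = (if pos r = pos s then 11 else 0))"
    by (simp only: vec_eq_iff)
  moreover have "(\<forall>r s. P (pos r) (pos s)) \<longleftrightarrow> (\<forall>i<11. \<forall>j<11. P i j)" for P
    using all[of "\<lambda>i. \<forall>s. P i (pos s)"] all by simp
  note all2 = this[of "\<lambda>i k. cmod (h i k) = 1"]
    this[of "\<lambda>i j. (\<Sum>k<11. h i k * cnj (h j k)) = (if i = j then 11 else 0)"]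
  ultimately show ?thesis
    unfolding complex_hadamard_def assms all2 by blast
qed

lemma entry_sum_permute:
  assumes "bij_betw \<tau> {..<11} {..<11}"
    and "\<And>i k. i < 11 \<Longrightarrow> k < 11 \<Longrightarrow> entry c (\<sigma> i) (\<tau> k) = entry c i k" and "i < 11" "j < 11"
  shows "(\<Sum>k<11. entry c (\<sigma> i) k * cnj (entry c (\<sigma> j) k)) = (\<Sum>k<11. entry c i k * cnj (entry c j k))"
  by (subst sum.reindex_bij_betw[OF assms(1), symmetric]) (simp add: assms(2-4))

text \<open>Distinct indices modulo 5 differ by 1 or 2 up to sign, so the two pair equations cover
  all cross terms of the squared sum: the square sum is \<open>1 + 2 * (2 + 2)\<close>.\<close>

lemma residual_square_sum:
  assumes "\<forall>k<10. residual a b k = 0"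
  shows "(\<Sum>j<5. (a j)\<^sup>2) = 9"
proof -
  have r: "a 0 + a 1 + a 2 + a 3 + a 4 = - 1"
    "a 0 * a 1 + a 1 * a 2 + a 2 * a 3 + a 3 * a 4 + a 4 * a 0 = - 2"
    "a 0 * a 2 + a 1 * a 3 + a 2 * a 4 + a 3 * a 0 + a 4 * a 1 = - 2"
    using assms[unfolded all_lt10] by (simp_all add: residual_def)
  have "(a 0 + a 1 + a 2 + a 3 + a 4)\<^sup>2 = 1" unfolding r by simp
  then show ?thesis using r(2,3) unfolding sum_lt5 by (simp add: power2_eq_square algebra_simps)
qed

text \<open>Only the inner products with rows 0 and 1 are expanded; the symmetries carry them to all
  other rows.\<close>

lemma complex_hadamard_L11:
  fixes \<alpha> :: "nat \<Rightarrow> real"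
  assumes res: "\<forall>k<10. residual (\<lambda>j. 2 * cos (\<alpha> j)) (\<lambda>j. 2 * sin (\<alpha> j)) k = 0"
  shows "complex_hadamard (L11 (\<lambda>j. cis (\<alpha> j)))"
proof -
  let ?c = "\<lambda>j. cis (\<alpha> j)"
  define S where "S i j = (\<Sum>k<11. entry ?c i k * cnj (entry ?c j k))" for i j
  define x y where "x j = cos (\<alpha> j)" and "y j = sin (\<alpha> j)" for j
  have c: "?c j = Complex (x j) (y j)" for j by (simp add: x_def y_def complex_eq_iff)
  have norm: "cmod (letter ?c n) = 1" for n by (simp add: letter_def)
  have r: "(x j)\<^sup>2 + (y j)\<^sup>2 = 1" for j by (simp add: x_def y_def)
  have "(\<Sum>j<5. (2 * x j)\<^sup>2) = 9"
    unfolding x_def by (rule residual_square_sum[OF res])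
  \<comment> \<open>By the circle equations the squared sines sum to \<open>5 - 9/4\<close>.\<close>
  then have eqs: "x 0 * x 0 + x 1 * x 1 + x 2 * x 2 + x 3 * x 3 + x 4 * x 4 = 9/4"
    "y 0 * y 0 + y 1 * y 1 + y 2 * y 2 + y 3 * y 3 + y 4 * y 4 = 11/4"
    using r[of 0] r[of 1] r[of 2] r[of 3] r[of 4] unfolding sum_lt5 by (simp_all add: power2_eq_square)
  have "x 0 + x 1 + x 2 + x 3 + x 4 = - 1/2"
    "x 0 * x 1 + x 1 * x 2 + x 2 * x 3 + x 3 * x 4 + x 4 * x 0 = - 1/2"
    "x 0 * x 2 + x 1 * x 3 + x 2 * x 4 + x 3 * x 0 + x 4 * x 1 = - 1/2"
    "y 0 * y 1 + y 1 * y 2 + y 2 * y 3 + y 3 * y 4 + y 4 * y 0 = 0"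
    "y 0 * y 2 + y 1 * y 3 + y 2 * y 4 + y 3 * y 0 + y 4 * y 1 = 0"
    using res[unfolded all_lt10] by (simp_all add: residual_def x_def y_def)
  note eqs = eqs this
  have S0: "S 0 j = (if 0 = j then 11 else 0)" if "j < 11" for j
  proof -
    have "\<forall>j<11. S 0 j = (if 0 = j then 11 else 0)"
      unfolding all_lt11 S_def sum_lt11 entry_def letter_index_def letter_def c complex_eq_iff
      using eqs by simp
    then show ?thesis using that by blast
  qed
  have S1: "S 1 j = (if 1 = j then 11 else 0)" if "j < 11" for j
  proof -
    have "\<forall>j<11. S 1 j = (if 1 = j then 11 else 0)"
      unfolding all_lt11 S_def sum_lt11 entry_def letter_index_def letter_def c complex_eq_iff
      using eqs by (simp add: algebra_simps)
    then show ?thesis using that by blast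
  qed
  have "\<forall>j<11. S i j = (if i = j then 11 else 0)" if "i < 11" for i
  proof (rule all_shift_flip[where P = "\<lambda>i. \<forall>j<11. S i j = (if i = j then 11 else 0)", OF _ _ _ _ that])
    show "\<forall>j<11. S 0 j = (if 0 = j then 11 else 0)" using S0 by blast
    show "\<forall>j<11. S 1 j = (if 1 = j then 11 else 0)" using S1 by blast
    show "\<forall>j<11. S 2 j = (if 2 = j then 11 else 0)"
    proof (intro allI impI)
      fix j :: nat assume "j < 11"
      have f: "flip 1 = 2" by (simp add: flip_def)
      then have "S 2 j = S (flip 1) (flip (flip j))" by (simp only: flip_flip[OF \<open>j < 11\<close>])
      moreover have "S (flip 1) (flip (flip j)) = S 1 (flip j)"
        unfolding S_def using \<open>j < 11\<close> flip_flip[of j] by (intro entry_sum_permute[OF bij_flip] entry_flip) auto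
      moreover have "1 = flip j \<longleftrightarrow> 2 = j"
      proof -
        have "flip 2 = 1" "flip (flip j) = j"
          using flip_flip[OF \<open>j < 11\<close>] by (simp_all add: flip_def)
        then show ?thesis using f by metis
      qed
      then have "S 1 (flip j) = (if 2 = j then 11 else 0)"
        using S1[of "flip j"] flip_flip[OF \<open>j < 11\<close>] by (simp only:)
      ultimately show "S 2 j = (if 2 = j then 11 else 0)" by (simp only:)
    qed
    fix p :: nat assume p9: "p \<in> {1..<9}" and IH: "\<forall>j<11. S p j = (if p = j then 11 else 0)"
    show "\<forall>j<11. S (p + 2) j = (if p + 2 = j then 11 else 0)"
    proof (intro allI impI)
      fix j :: nat assume "j < 11"
      then obtain j' where j': "j = shift j'" "j' < 11"
        using bij_shift unfolding bij_betw_def by (metis imageE lessThan_iff)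
      have p: "shift p = p + 2" "p < 11" using p9 by (auto simp: shift_def)
      have "S (p + 2) j = S p j'"
        unfolding S_def j' p(1)[symmetric] using p j' by (intro entry_sum_permute[OF bij_shift] entry_shift)
      also have "\<dots> = (if p = j' then 11 else 0)" using IH j' by simp
      also have "p = j' \<longleftrightarrow> p + 2 = j"
        using bij_shift p j' by (auto simp: bij_betw_def inj_on_def)
      finally show "S (p + 2) j = (if p + 2 = j then 11 else 0)" .
    qed
  qed
  then show ?thesis
    unfolding complex_hadamard_iff[of "L11 ?c", OF L11_entry] S_def by (simp add: entry_def norm)
qed

section \<open>Isolation\<close>

text \<open>Up to the factor \<open>\<i>\<close>, the derivative of the inner product of rows
  \<open>i\<close> and \<open>j\<close> when each \<open>H i k\<close> turns by the angle
  \<open>R i k\<close>.\<close>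

definition variation :: "(nat \<Rightarrow> nat \<Rightarrow> complex) \<Rightarrow> (nat \<Rightarrow> nat \<Rightarrow> real) \<Rightarrow> nat \<Rightarrow> nat \<Rightarrow> complex" where
  "variation H R i j = (\<Sum>k<11. H i k * cnj (H j k) * of_real (R i k - R j k))"

text \<open>For skew-Hermitian \<open>N\<close>, exchanging \<open>i\<close> and \<open>j\<close>
  negates the real part of \<open>N i j * H i k * cnj (H j k)\<close>. Hence the two halves of
  \<open>R i k - R j k\<close> contribute equally, which is the factor 2.\<close>

lemma variation_dual:
  assumes skew: "\<And>i j. N j i = - cnj (N i j)"
  shows "(\<Sum>i<11. \<Sum>k<11. R i k * Re (H i k * (\<Sum>j<11. N i j * cnj (H j k))))
    = Re (\<Sum>i<11. \<Sum>j<11. N i j * variation H R i j) / 2"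
proof -
  define t where "t i j k = N i j * H i k * cnj (H j k)" for i j k
  have t: "Re (t i j k) = - Re (t j i k)" for i j k
    unfolding t_def by (subst skew) (simp add: algebra_simps)
  have "N i j * variation H R i j = (\<Sum>k<11. t i j k * of_real (R i k - R j k))" for i j
    unfolding variation_def t_def sum_distrib_left by (simp only: mult.assoc)
  then have "Re (\<Sum>i<11. \<Sum>j<11. N i j * variation H R i j) = (\<Sum>i<11. \<Sum>j<11. \<Sum>k<11. Re (t i j k) * (R i k - R j k))"
    by (simp only: Re_sum Re_complex_of_real Im_complex_of_real times_complex.sel mult_zero_right diff_zero)
  also have "\<dots> = (\<Sum>i<11. \<Sum>j<11. \<Sum>k<11. Re (t i j k) * R i k) - (\<Sum>i<11. \<Sum>j<11. \<Sum>k<11. Re (t i j k) * R j k)"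
    by (simp add: right_diff_distrib sum_subtractf)
  also have "(\<Sum>i<11. \<Sum>j<11. \<Sum>k<11. Re (t i j k) * R j k) = (\<Sum>j<11. \<Sum>i<11. \<Sum>k<11. Re (t i j k) * R j k)"
    by (rule sum.swap)
  also have "\<dots> = (\<Sum>i<11. \<Sum>j<11. \<Sum>k<11. - (Re (t i j k) * R i k))"
    by (intro sum.cong refl) (subst t, simp)
  also have "\<dots> = - (\<Sum>i<11. \<Sum>j<11. \<Sum>k<11. Re (t i j k) * R i k)"
    by (simp only: sum_negf)
  finally have "Re (\<Sum>i<11. \<Sum>j<11. N i j * variation H R i j) = 2 * (\<Sum>i<11. \<Sum>j<11. \<Sum>k<11. Re (t i j k) * R i k)"
    by simp
  also have "(\<Sum>i<11. \<Sum>j<11. \<Sum>k<11. Re (t i j k) * R i k) = (\<Sum>i<11. \<Sum>k<11. \<Sum>j<11. Re (t i j k) * R i k)"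
    by (intro sum.cong refl sum.swap)
  also have "\<dots> = (\<Sum>i<11. \<Sum>k<11. R i k * Re (H i k * (\<Sum>j<11. N i j * cnj (H j k))))"
    by (simp only: t_def sum_distrib_left Re_sum mult_ac)
  finally show ?thesis by simp
qed

lemma norm_mult_diff_le:
  fixes x y x' y' :: complex
  assumes "cmod x = 1" "cmod y = 1" "cmod (x - x') \<le> \<epsilon>" "cmod (y - y') \<le> \<epsilon>" "\<epsilon> \<le> 1"
  shows "cmod (x * cnj y - x' * cnj y') \<le> 3 * \<epsilon>"
proof -
  have "x * cnj y - x' * cnj y' = x * cnj (y - y') + (x - x') * cnj y - (x - x') * cnj (y - y')"
    by (simp add: algebra_simps)
  also have "cmod \<dots> \<le> cmod (x * cnj (y - y')) + cmod ((x - x') * cnj y) + cmod ((x - x') * cnj (y - y'))"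
    by (intro order_trans[OF norm_triangle_ineq4] add_right_mono norm_triangle_ineq)
  also have "\<dots> = cmod (y - y') + cmod (x - x') + cmod (x - x') * cmod (y - y')"
    using assms by (simp add: norm_mult del: complex_cnj_diff)
  also have "\<dots> \<le> \<epsilon> + \<epsilon> + 1 * \<epsilon>"
    using assms by (intro add_mono mult_mono) auto
  finally show ?thesis by simp
qed

text \<open>Pairing with \<open>N\<close> reads off \<open>R 1 q\<close> with weights in error by at
  most 8/100 at \<open>H0\<close>; passing to \<open>H\<close> costs at most
  \<open>10 * 20 * 3/10000 = 6/100\<close>, the 10 counting columns. The total stays below 3/10. The
  first order terms contribute \<open>20 * y / 2\<close>.\<close>

lemma variation_dual_bound:
  assumes skew: "\<And>i j. N j i = - cnj (N i j)"
    and H: "\<And>i k. i < 11 \<Longrightarrow> k < 11 \<Longrightarrow> cmod (H i k) = 1"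
    and H0: "\<And>i k. i < 11 \<Longrightarrow> k < 11 \<Longrightarrow> cmod (H i k - H0 i k) \<le> 1/10000"
    and N: "(\<Sum>i<11. \<Sum>j<11. cmod (N i j)) \<le> 20"
    and err: "(\<Sum>i\<in>{1..<11}. \<Sum>k\<in>{1..<11}. \<bar>(if i = 1 \<and> k = q then 1 else 0) -
        Re (H0 i k * (\<Sum>j<11. N i j * cnj (H0 j k)))\<bar>) \<le> 8/100"
    and R: "\<And>i k. i < 11 \<Longrightarrow> k < 11 \<Longrightarrow> \<bar>R i k\<bar> \<le> \<rho>" "\<And>k. R 0 k = 0" "\<And>i. R i 0 = 0"
    and variation: "\<And>i j. i < 11 \<Longrightarrow> j < 11 \<Longrightarrow> cmod (variation H R i j) \<le> y"
    and q: "q \<in> {1..<11}"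
  shows "\<bar>R 1 q\<bar> \<le> 3/10 * \<rho> + 10 * y"
proof -
  define G where "G H i k = Re (H i k * (\<Sum>j<11. N i j * cnj (H j k)))" for H and i k :: nat
  define \<delta> where "\<delta> i k = (if i = 1 \<and> k = q then 1 else 0 :: real)" for i k :: nat
  have "\<rho> \<ge> 0" using R(1)[of 0 0] by simp
  have "y \<ge> 0" using order_trans[OF norm_ge_zero variation[of 0 0]] by simp
  have dG: "\<bar>G H i k - G H0 i k\<bar> \<le> (\<Sum>j<11. cmod (N i j)) * (3/10000)" if "i < 11" "k < 11" for i k
  proof -
    have "G H i k - G H0 i k = Re (\<Sum>j<11. N i j * (H i k * cnj (H j k) - H0 i k * cnj (H0 j k)))"
      by (simp add: G_def sum_distrib_left right_diff_distrib sum_subtractf mult.left_commute)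
    also have "\<bar>\<dots>\<bar> \<le> cmod (\<Sum>j<11. N i j * (H i k * cnj (H j k) - H0 i k * cnj (H0 j k)))"
      by (rule abs_Re_le_cmod)
    also have "\<dots> \<le> (\<Sum>j<11. cmod (N i j) * (3 * (1/10000)))"
      using that by (intro order_trans[OF norm_sum] sum_mono)
        (auto simp only: norm_mult lessThan_iff intro!: mult_left_mono norm_mult_diff_le H H0 norm_ge_zero)
    finally have "\<bar>G H i k - G H0 i k\<bar> \<le> (\<Sum>j<11. cmod (N i j)) * (3 * (1/10000))"
      by (simp only: sum_distrib_right)
    then show ?thesis by simp
  qed
  have "(\<Sum>i\<in>{1..<11}. \<Sum>k\<in>{1..<11}. \<bar>\<delta> i k - G H i k\<bar>)
      \<le> (\<Sum>i\<in>{1..<11}. \<Sum>k\<in>{1..<11}. \<bar>\<delta> i k - G H0 i k\<bar> + (\<Sum>j<11. cmod (N i j)) * (3/10000))"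
  proof (intro sum_mono)
    fix i k :: nat assume "i \<in> {1..<11}" "k \<in> {1..<11}"
    then have "i < 11" "k < 11" by auto
    from dG[OF this]
    show "\<bar>\<delta> i k - G H i k\<bar> \<le> \<bar>\<delta> i k - G H0 i k\<bar> + (\<Sum>j<11. cmod (N i j)) * (3/10000)"
      by linarith
  qed
  also have "\<dots> \<le> 8/100 + (\<Sum>i\<in>{1..<11}. \<Sum>j<11. cmod (N i j)) * (3/1000)"
    using err by (simp add: sum.distrib G_def \<delta>_def sum_distrib_right[symmetric] sum_distrib_left[symmetric] sum_divide_distrib[symmetric])
  also have "(\<Sum>i\<in>{1..<11}. \<Sum>j<11. cmod (N i j)) \<le> (\<Sum>i<11. \<Sum>j<11. cmod (N i j))"
    by (intro sum_mono2 sum_nonneg) auto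
  finally have \<delta>G: "(\<Sum>i\<in>{1..<11}. \<Sum>k\<in>{1..<11}. \<bar>\<delta> i k - G H i k\<bar>) \<le> 3/10"
    using N by simp
  have zero: "{..<11} = insert 0 {1..<11::nat}" by auto
  have "(\<Sum>i\<in>{1..<11}. \<Sum>k\<in>{1..<11}. R i k * \<delta> i k) = R 1 q"
  proof -
    have "(\<Sum>k\<in>{1..<11}. R i k * \<delta> i k) = (if i = 1 then R 1 q else 0)" for i
      using q by (simp add: \<delta>_def if_distrib[where f="\<lambda>x. R i _ * x"] cong: if_cong)
    then show ?thesis by simp
  qed
  \<comment> \<open>Row 0 and column 0 drop out because \<open>R\<close> vanishes there.\<close>
  moreover have "(\<Sum>i\<in>{1..<11}. \<Sum>k\<in>{1..<11}. R i k * G H i k) = (\<Sum>i<11. \<Sum>k<11. R i k * G H i k)"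
    by (simp add: zero R)
  ultimately have "R 1 q = (\<Sum>i\<in>{1..<11}. \<Sum>k\<in>{1..<11}. R i k * (\<delta> i k - G H i k)) + (\<Sum>i<11. \<Sum>k<11. R i k * G H i k)"
    by (simp only: right_diff_distrib sum_subtractf)
  moreover have "\<bar>\<Sum>i\<in>{1..<11}. \<Sum>k\<in>{1..<11}. R i k * (\<delta> i k - G H i k)\<bar> \<le> \<rho> * (3/10)"
  proof -
    have "\<bar>R i k * (\<delta> i k - G H i k)\<bar> \<le> \<rho> * \<bar>\<delta> i k - G H i k\<bar>" if "i \<in> {1..<11}" "k \<in> {1..<11}" for i k
      unfolding abs_mult using R(1)[of i k] that by (intro mult_right_mono) auto
    then have "\<bar>\<Sum>i\<in>{1..<11}. \<Sum>k\<in>{1..<11}. R i k * (\<delta> i k - G H i k)\<bar>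
        \<le> (\<Sum>i\<in>{1..<11}. \<Sum>k\<in>{1..<11}. \<rho> * \<bar>\<delta> i k - G H i k\<bar>)"
      by (intro order_trans[OF sum_abs] sum_mono)
    also have "\<dots> = \<rho> * (\<Sum>i\<in>{1..<11}. \<Sum>k\<in>{1..<11}. \<bar>\<delta> i k - G H i k\<bar>)"
      by (simp only: sum_distrib_left)
    also have "\<dots> \<le> \<rho> * (3/10)"
      using \<delta>G \<open>\<rho> \<ge> 0\<close> by (rule mult_left_mono)
    finally show ?thesis .
  qed
  moreover have "\<bar>\<Sum>i<11. \<Sum>k<11. R i k * G H i k\<bar> \<le> 10 * y"
  proof -
    have "cmod (\<Sum>i<11. \<Sum>j<11. N i j * variation H R i j) \<le> (\<Sum>i<11. \<Sum>j<11. cmod (N i j) * y)"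
      by (intro sum_norm_le) (auto simp: norm_mult intro!: mult_left_mono variation)
    also have "\<dots> \<le> 20 * y"
      unfolding sum_distrib_right[symmetric] using N \<open>y \<ge> 0\<close> by (rule mult_right_mono)
    finally have "\<bar>Re (\<Sum>i<11. \<Sum>j<11. N i j * variation H R i j)\<bar> \<le> 20 * y"
      using abs_Re_le_cmod order_trans by blast
    moreover have "(\<Sum>i<11. \<Sum>k<11. R i k * G H i k) = Re (\<Sum>i<11. \<Sum>j<11. N i j * variation H R i j) / 2"
      unfolding G_def by (rule variation_dual[OF skew])
    ultimately show ?thesis by linarith
  qed
  ultimately show ?thesis by linarith
qed

section \<open>Exact arithmetic for the certificates\<close>

type_synonym gauss_int = "int \<times> int"

text \<open>Gaussian integers as integer pairs allow the certificates to be checked by exact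
  evaluation.\<close>

definition gauss :: "gauss_int \<Rightarrow> complex" where
  "gauss z = Complex (of_int (fst z)) (of_int (snd z))"

text \<open>The letters at the approximate solution, multiplied by \<open>2 * 10^6\<close>.\<close>

definition letters :: "gauss_int list" where
  "letters = [(2000000, 0), (-1844914, -772199), (-1844914, 772199), (-142842, -1994892), (-142842, 1994892),
     (-1240610, 1568722), (-1240610, -1568722), (1995650, -131840), (1995650, 131840),
     (232717, -1986415), (232717, 1986415)]"

text \<open>
  The strict upper triangles of five skew-Hermitian matrices, multiplied by 1000. They are rounded minimum norm
  solutions \<open>N\<close> of the linear system \<open>Re (H\<^sub>i\<^sub>k \<Sum>\<^sub>j N\<^sub>i\<^sub>j cnj(H\<^sub>j\<^sub>k)) = (if (i, k) = (1, q) then 1 else 0)\<close> with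
  \<open>i, k \<ge> 1\<close>, for \<open>q = 1, 3, 5, 7, 9\<close>.
\<close>

definition multipliers :: "gauss_int list list list" where
  "multipliers = [
    [
      [(265, 17), (84, -53), (-15, 162), (175, -19), (54, -55), (-54, -67), (212, -72), (82, 70), (139, 112), (56, -70)],
      [(3, -129), (-35, 74), (-183, -94), (-191, 119), (-97, -30), (-93, -148), (-52, 40), (-62, -3), (-24, -49)],
      [(36, 65), (-48, 46), (-4, 83), (17, -34), (-51, 9), (-9, 109), (67, -35), (80, -4)],
      [(-31, 67), (61, 25), (-41, -5), (11, 39), (23, 52), (-56, 37), (19, -96)],
      [(-31, 20), (-8, -57), (97, 79), (-19, -103), (-85, 6), (-41, -16)],
      [(62, -56), (-194, 92), (-92, 48), (80, 2), (33, 14)],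
      [(-125, -89), (-27, -8), (66, -139), (-35, -26)],
      [(-10, 112), (-106, -3), (-26, -8)],
      [(-45, 44), (-59, -43)],
      [(-2, -34)]],
    [
      [(50, 190), (145, 9), (96, -11), (253, -81), (201, 50), (-41, -130), (97, 63), (-96, 51), (141, -90), (154, 53)],
      [(-115, 59), (-166, -90), (-308, -56), (-47, -57), (-69, 139), (80, 150), (-7, 17), (-383, 42), (64, -90)],
      [(-109, -9), (-124, -5), (99, -53), (62, 70), (-59, 51), (160, -61), (100, 48), (-100, -19)],
      [(-30, -112), (-156, -46), (168, -98), (9, -10), (-99, -106), (8, -63), (-80, -137)],
      [(143, 66), (-35, 32), (32, 79), (-83, -53), (-173, 35), (-93, 93)],
      [(42, -12), (-7, -6), (-167, -48), (287, 81), (85, -76)],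
      [(-206, 94), (134, 12), (95, 101), (106, -94)],
      [(10, 36), (-65, 36), (1, 80)],
      [(-6, -45), (-142, -70)],
      [(5, -10)]],
    [
      [(190, -102), (105, 40), (37, 130), (158, -52), (200, -30), (149, -100), (146, 120), (14, -60), (14, 0), (-14, -12)],
      [(-66, 120), (-135, 66), (-156, -18), (-47, 28), (97, 98), (-134, 85), (-18, -18), (-232, -24), (-120, -121)],
      [(-94, -15), (19, -15), (89, -44), (57, 61), (-51, 48), (34, -73), (21, 48), (-38, 12)],
      [(-72, 24), (-207, -21), (-60, -23), (38, -53), (8, 78), (56, 32), (45, -158)],
      [(-48, -1), (-124, -16), (75, -28), (23, -8), (-69, 57), (94, -34)],
      [(-6, -69), (-153, 20), (-45, -49), (165, -28), (27, -65)],
      [(24, 57), (13, 41), (25, 23), (52, -12)],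
      [(-5, 87), (13, -22), (-64, 21)],
      [(5, -8), (20, -12)],
      [(-2, -7)]],
    [
      [(-99, 36), (100, 24), (28, -108), (267, 34), (174, 58), (21, -124), (280, 39), (70, -31), (118, 101), (42, -80)],
      [(-16, 9), (-130, 107), (-269, 53), (-181, -69), (-24, 263), (-166, 49), (-67, 90), (-199, -36), (-48, 88)],
      [(-31, -93), (-43, -32), (45, -69), (27, -68), (-43, -108), (10, -24), (76, -24), (43, 7)],
      [(-65, 56), (-121, 50), (-57, 54), (54, -151), (8, 68), (16, 127), (32, 132)],
      [(-67, -67), (-23, -25), (157, -107), (-18, 59), (-127, -19), (-31, -91)],
      [(24, 119), (-283, -88), (-105, -30), (175, -84), (38, 46)],
      [(-76, 21), (-3, 33), (61, -123), (-14, 87)],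
      [(-10, -3), (-61, -86), (-7, -94)],
      [(-64, 74), (-52, 23)],
      [(-3, -70)]],
    [
      [(91, 177), (70, -4), (-97, 58), (97, 46), (134, -57), (161, 86), (122, 58), (73, -124), (249, 41), (100, -30)],
      [(-125, 70), (17, 107), (-184, 76), (-108, 21), (36, -82), (18, -29), (-189, -23), (-145, -71), (-227, -9)],
      [(-6, -21), (9, -23), (1, -24), (113, -21), (-85, 20), (120, -37), (-103, -13), (-104, 17)],
      [(-41, 71), (-78, 30), (27, 55), (-49, -54), (-51, 120), (34, 89), (71, 7)],
      [(76, -95), (-147, -8), (-9, -149), (-52, 66), (-59, -25), (71, -85)],
      [(23, 1), (-92, -30), (-275, -25), (230, -134), (139, 12)],
      [(-235, -34), (127, -1), (179, -25), (141, 54)],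
      [(-33, -41), (-205, -70), (-90, -42)],
      [(-191, 30), (-90, 52)],
      [(-10, 24)]]]"

text \<open>Row \<open>i\<close> of \<open>U\<close> begins at column \<open>i + 1\<close>, which
  explains the offsets; the other half is minus the conjugate, as skew-Hermitian symmetry
  demands.\<close>

definition skew_entry :: "gauss_int list list \<Rightarrow> nat \<Rightarrow> nat \<Rightarrow> gauss_int" where
  "skew_entry U i j = (if i < j then U ! i ! (j - i - 1)
     else if j < i then (- fst (U ! j ! (i - j - 1)), snd (U ! j ! (i - j - 1))) else (0, 0))"

text \<open>The complex number \<open>n * cnj h + z\<close>, so that \<open>cdot\<close> is the
  Hermitian product.\<close>

fun mult_add :: "gauss_int \<Rightarrow> gauss_int \<Rightarrow> gauss_int \<Rightarrow> gauss_int" where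
  "mult_add (a, b) (u, v) (x, y) = (a * u + b * v + x, b * u - a * v + y)"

fun cdot :: "gauss_int list \<Rightarrow> gauss_int list \<Rightarrow> gauss_int" where
  "cdot (n # ns) (h # hs) = mult_add n h (cdot ns hs)"
| "cdot _ _ = (0, 0)"

fun re_mult :: "gauss_int \<Rightarrow> gauss_int \<Rightarrow> int" where
  "re_mult (a, b) (x, y) = a * x - b * y"

text \<open>Recursion along tabulated lists avoids repeated indexing during evaluation; the last
  argument lists the columns of the matrix.\<close>

fun row_err :: "int list \<Rightarrow> gauss_int list \<Rightarrow> gauss_int list \<Rightarrow> gauss_int list list \<Rightarrow> int" where
  "row_err (d # ds) (h # hs) n (c # cs) = \<bar>d - re_mult h (cdot n c)\<bar> + row_err ds hs n cs"
| "row_err _ _ _ _ = 0"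

fun total_err :: "int list list \<Rightarrow> gauss_int list list \<Rightarrow> gauss_int list list \<Rightarrow> gauss_int list list \<Rightarrow> int" where
  "total_err (d # ds) (h # hs) (n # ns) C = row_err d h n C + total_err ds hs ns C"
| "total_err _ _ _ _ = 0"

definition table :: "(nat \<Rightarrow> nat \<Rightarrow> 'a) \<Rightarrow> nat list \<Rightarrow> nat list \<Rightarrow> 'a list list" where
  "table f xs ys = map (\<lambda>i. map (f i) ys) xs"

text \<open>
  The \<open>l\<^sup>1\<close> error of such a solution in units of \<open>1 / (4 * 10^15)\<close>, since the three factors are scaled by
  \<open>2 * 10^6\<close>, \<open>1000\<close> and \<open>2 * 10^6\<close>.
\<close>

definition cert_err :: "nat \<Rightarrow> gauss_int list list \<Rightarrow> int" where
  "cert_err q U = total_err (table (\<lambda>i k. if i = 1 \<and> k = q then 4000000000000000 else 0) [1..<11] [1..<11])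
     (table (\<lambda>i k. letters ! letter_index i k) [1..<11] [1..<11]) (table (skew_entry U) [1..<11] [0..<11])
     (table (\<lambda>k j. letters ! letter_index j k) [1..<11] [0..<11])"

definition cert_size :: "gauss_int list list \<Rightarrow> int" where
  "cert_size U = sum_list (map (\<lambda>r. sum_list (map (\<lambda>z. \<bar>fst z\<bar> + \<bar>snd z\<bar>) r)) (table (skew_entry U) [0..<11] [0..<11]))"

text \<open>After division by 1000 the bound is the 20 required by
  \<open>variation_dual_bound\<close>.\<close>

lemma certificate_sizes: "\<forall>U\<in>set multipliers. cert_size U \<le> 20000"
  by code_simp

text \<open>The right-hand side is \<open>8/100 * 4 * 10^15\<close>, the admissible error after
  scaling.\<close>

lemma certificate_0: "cert_err 1 (multipliers ! 0) \<le> 320000000000000"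
  by code_simp
lemma certificate_1: "cert_err 3 (multipliers ! 1) \<le> 320000000000000"
  by code_simp
lemma certificate_2: "cert_err 5 (multipliers ! 2) \<le> 320000000000000"
  by code_simp
lemma certificate_3: "cert_err 7 (multipliers ! 3) \<le> 320000000000000"
  by code_simp
lemma certificate_4: "cert_err 9 (multipliers ! 4) \<le> 320000000000000"
  by code_simp

lemma gauss_mult_add: "gauss (mult_add n h z) = gauss n * cnj (gauss h) + gauss z"
  by (cases n; cases h; cases z) (simp add: gauss_def complex_eq_iff)

lemma gauss_cdot: "gauss (cdot (map f js) (map g js)) = (\<Sum>j\<leftarrow>js. gauss (f j) * cnj (gauss (g j)))"
  by (induction js) (simp_all add: gauss_mult_add, simp add: gauss_def complex_eq_iff)

lemma re_mult: "real_of_int (re_mult h z) = Re (gauss h * gauss z)"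
  by (cases h; cases z) (simp add: gauss_def)

lemma row_err: "row_err (map d ks) (map h ks) n (map c ks) = (\<Sum>k\<leftarrow>ks. \<bar>d k - re_mult (h k) (cdot n (c k))\<bar>)"
  by (induction ks) simp_all

lemma total_err: "total_err (map d js) (map h js) (map n js) C = (\<Sum>i\<leftarrow>js. row_err (d i) (h i) (n i) C)"
  by (induction js) simp_all

lemma cert_err_eq:
  "real_of_int (cert_err q U) =
    (\<Sum>i\<in>{1..<11}. \<Sum>k\<in>{1..<11}. \<bar>(if i = 1 \<and> k = q then 4 * 10^15 else 0) -
      Re (gauss (letters ! letter_index i k) * (\<Sum>j<11. gauss (skew_entry U i j) * cnj (gauss (letters ! letter_index j k))))\<bar>)"
  unfolding cert_err_def table_def total_err row_err interv_sum_list_conv_sum_set_nat set_upt of_int_sum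
  by (intro sum.cong refl)
    (simp add: re_mult gauss_cdot interv_sum_list_conv_sum_set_nat atLeast0LessThan del: upt_rec_numeral times_complex.sel)

lemma cert_size_ge: "(\<Sum>i<11. \<Sum>j<11. cmod (gauss (skew_entry U i j))) \<le> real_of_int (cert_size U)"
proof -
  have "cmod (gauss z) \<le> real_of_int (\<bar>fst z\<bar> + \<bar>snd z\<bar>)" for z
    using cmod_le[of "gauss z"] by (simp add: gauss_def)
  then show ?thesis
    unfolding cert_size_def table_def map_map o_def interv_sum_list_conv_sum_set_nat of_int_sum set_upt atLeast0LessThan
    by (intro sum_mono)
qed

lemma gauss_skew_entry: "gauss (skew_entry U j i) = - cnj (gauss (skew_entry U i j))"
  by (auto simp: skew_entry_def gauss_def complex_eq_iff)

text \<open>Collects the enclosures on which both isolation and the exclusion of the Butson type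
  rest.\<close>

definition approx_phases :: "(nat \<Rightarrow> complex) \<Rightarrow> bool" where
  "approx_phases c \<longleftrightarrow> (\<forall>j<5. cmod (c j) = 1 \<and>
     \<bar>2 * Re (c j) - a0 j\<bar> \<le> 1/10000 \<and> \<bar>2 * Im (c j) - b0 j\<bar> \<le> 1/10000)"

lemma norm_letter: "approx_phases c \<Longrightarrow> n < 11 \<Longrightarrow> cmod (letter c n) = 1"
  by (auto simp: letter_def approx_phases_def elim!: oddE evenE)

text \<open>Halving the enclosures locates each coordinate within 1/20000, and the modulus is at
  most the sum of both deviations.\<close>

lemma letter_approx:
  assumes "approx_phases c" "n < 11"
  shows "cmod (letter c n - gauss (letters ! n) / 2000000) \<le> 1/10000"
proof -
  have est: "cmod (z - Complex (x / 2) (y / 2)) \<le> 1/10000"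
    if "\<bar>2 * Re z - x\<bar> \<le> 1/10000 \<and> \<bar>2 * Im z - y\<bar> \<le> 1/10000" for z x y
    using that cmod_le[of "z - Complex (x / 2) (y / 2)"] unfolding minus_complex.sel complex.sel by linarith
  have c: "\<bar>2 * Re (c j) - a0 j\<bar> \<le> 1/10000 \<and> \<bar>2 * Im (c j) - b0 j\<bar> \<le> 1/10000" if "j < 5" for j
    using assms(1) that by (auto simp: approx_phases_def)
  have letters: "\<forall>j<5. gauss (letters ! (2 * j + 1)) / 2000000 = Complex (a0 j / 2) (b0 j / 2) \<and>
      gauss (letters ! (2 * j + 2)) / 2000000 = Complex (a0 j / 2) (- b0 j / 2)"
    unfolding all_lt5 by (simp add: letters_def gauss_def a0_def b0_def complex_eq_iff)
  consider "n = 0" | j where "n = 2 * j + 1" "j < 5" | j where "n = 2 * j + 2" "j < 5"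
  proof -
    have "n = 0 \<or> n = 2 * (n div 2) + 1 \<and> n div 2 < 5 \<or> n = 2 * (n div 2 - 1) + 2 \<and> n div 2 - 1 < 5"
      using assms(2) by presburger
    then show thesis using that by blast
  qed
  then show ?thesis
  proof cases
    case 1
    have "gauss (letters ! 0) / 2000000 = 1" by (simp add: letters_def gauss_def complex_eq_iff)
    then show ?thesis using 1 by (simp add: letter_def)
  next
    case 2
    then show ?thesis using est[OF c[of j]] letters by (simp add: letter_def)
  next
    case 3
    then have "letter c n - gauss (letters ! n) / 2000000 = cnj (c j - Complex (a0 j / 2) (b0 j / 2))"
      using letters by (simp add: letter_def complex_eq_iff)
    then show ?thesis using est[OF c[of j]] 3 by (simp only: complex_mod_cnj)
  qed
qed

lemma norm_entry: "approx_phases c \<Longrightarrow> cmod (entry c i k) = 1"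
  unfolding entry_def by (intro norm_letter letter_index_less)

text \<open>A small dephased perturbation whose first order terms are at most \<open>y\<close>,
  packaged so that the symmetries map such perturbations to each other.\<close>

definition near_solution :: "(nat \<Rightarrow> complex) \<Rightarrow> real \<Rightarrow> real \<Rightarrow> (nat \<Rightarrow> nat \<Rightarrow> real) \<Rightarrow> bool" where
  "near_solution c \<rho> y R \<longleftrightarrow> (\<forall>i<11. \<forall>k<11. \<bar>R i k\<bar> \<le> \<rho>) \<and> (\<forall>k. R 0 k = 0) \<and> (\<forall>i. R i 0 = 0) \<and>
     (\<forall>i<11. \<forall>j<11. cmod (variation (entry c) R i j) \<le> y)"

lemma certificate:
  assumes "q \<in> {1, 3, 5, 7, 9}"
  shows "\<exists>U. cert_size U \<le> 20000 \<and>
    cert_err q U \<le> 320000000000000"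
proof -
  have "length multipliers = 5" by (simp add: multipliers_def)
  then have "\<forall>m<5. cert_size (multipliers ! m) \<le> 20000"
    using certificate_sizes nth_mem[of _ multipliers] by metis
  note s = this[unfolded all_lt5]
  from assms consider "q = 1" | "q = 3" | "q = 5" | "q = 7" | "q = 9" by auto
  then show ?thesis
    by cases (use s certificate_0 certificate_1 certificate_2 certificate_3 certificate_4 in blast)+
qed

text \<open>These are the five columns with a stored certificate; the scalings by 1000 and
  \<open>2 * 10^6\<close> are undone here.\<close>

lemma near_solution_1q:
  assumes c: "approx_phases c" and R: "near_solution c \<rho> y R" and q: "q \<in> {1, 3, 5, 7, 9}"
  shows "\<bar>R 1 q\<bar> \<le> 3/10 * \<rho> + 10 * y"
proof -
  obtain U where U: "cert_size U \<le> 20000"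
    "cert_err q U \<le> 320000000000000"
    using certificate[OF q] by blast
  define N where "N i j = gauss (skew_entry U i j) / 1000" for i j
  define H0 where "H0 i k = gauss (letters ! letter_index i k) / 2000000" for i k
  show ?thesis
  proof (rule variation_dual_bound)
    show "N j i = - cnj (N i j)" for i j
      unfolding N_def by (subst gauss_skew_entry) simp
    show "cmod (entry c i k) = 1" for i k by (rule norm_entry[OF c])
    show "cmod (entry c i k - H0 i k) \<le> 1/10000" for i k
      unfolding entry_def H0_def by (rule letter_approx[OF c letter_index_less])
    have "(\<Sum>i<11. \<Sum>j<11. cmod (N i j)) = (\<Sum>i<11. \<Sum>j<11. cmod (gauss (skew_entry U i j))) / 1000"
      by (simp add: N_def norm_divide sum_divide_distrib)
    also have "\<dots> \<le> 20"
      using cert_size_ge[of U] U(1) by linarith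
    finally show "(\<Sum>i<11. \<Sum>j<11. cmod (N i j)) \<le> 20" .
    have "\<bar>(if i = 1 \<and> k = q then 1 else 0) - Re (H0 i k * (\<Sum>j<11. N i j * cnj (H0 j k)))\<bar> =
        \<bar>(if i = 1 \<and> k = q then 4 * 10^15 else 0) -
          Re (gauss (letters ! letter_index i k) * (\<Sum>j<11. gauss (skew_entry U i j) * cnj (gauss (letters ! letter_index j k))))\<bar> / (4 * 10^15)"
      for i k
    proof -
      let ?S = "\<Sum>j<11. gauss (skew_entry U i j) * cnj (gauss (letters ! letter_index j k))"
      have "N i j * cnj (H0 j k) = gauss (skew_entry U i j) * cnj (gauss (letters ! letter_index j k)) / of_real (2 * 10^9)" for j
        by (simp add: N_def H0_def)
      then have "(\<Sum>j<11. N i j * cnj (H0 j k)) = ?S / of_real (2 * 10^9)"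
        by (simp only: sum_divide_distrib)
      then have "H0 i k * (\<Sum>j<11. N i j * cnj (H0 j k)) = H0 i k * (?S / of_real (2 * 10^9))"
        by (simp only:)
      also have "\<dots> = gauss (letters ! letter_index i k) * ?S / of_real (4 * 10^15)"
        by (simp add: H0_def)
      finally have "H0 i k * (\<Sum>j<11. N i j * cnj (H0 j k)) = gauss (letters ! letter_index i k) * ?S / of_real (4 * 10^15)" .
      then have "Re (H0 i k * (\<Sum>j<11. N i j * cnj (H0 j k))) = Re (gauss (letters ! letter_index i k) * ?S) / (4 * 10^15)"
        by (simp only: Re_divide_of_real)
      then show ?thesis
        by (simp only: abs_divide[symmetric] diff_divide_distrib[symmetric] divide_self_if) (auto simp: abs_if field_simps)
    qed
    then have "(\<Sum>i\<in>{1..<11}. \<Sum>k\<in>{1..<11}. \<bar>(if i = 1 \<and> k = q then 1 else 0) -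
        Re (H0 i k * (\<Sum>j<11. N i j * cnj (H0 j k)))\<bar>) =
        real_of_int (cert_err q U) / (4 * 10^15)"
      unfolding cert_err_eq by (simp only: sum_divide_distrib)
    also have "\<dots> \<le> 8/100"
      using U(2) by (simp add: divide_le_eq)
    finally show "(\<Sum>i\<in>{1..<11}. \<Sum>k\<in>{1..<11}. \<bar>(if i = 1 \<and> k = q then 1 else 0) -
        Re (H0 i k * (\<Sum>j<11. N i j * cnj (H0 j k)))\<bar>) \<le> 8/100" .
    show "q \<in> {1..<11}" using q by auto
  qed (use R in \<open>auto simp: near_solution_def\<close>)
qed

section \<open>Spreading the estimate by symmetry\<close>

lemma near_solution_permute:
  assumes R: "near_solution c \<rho> y R"
    and \<sigma>: "bij_betw \<sigma> {..<11} {..<11}" "\<sigma> 0 = 0" and \<tau>: "bij_betw \<tau> {..<11} {..<11}" "\<tau> 0 = 0"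
    and eq: "\<And>i k. i < 11 \<Longrightarrow> k < 11 \<Longrightarrow> entry c (\<sigma> i) (\<tau> k) = entry c i k"
  shows "near_solution c \<rho> y (\<lambda>i k. R (\<sigma> i) (\<tau> k))"
proof -
  have lt: "\<sigma> i < 11" "\<tau> i < 11" if "i < 11" for i
    using that \<sigma> \<tau> by (auto simp: bij_betw_def)
  have "variation (entry c) (\<lambda>i k. R (\<sigma> i) (\<tau> k)) i j = variation (entry c) R (\<sigma> i) (\<sigma> j)" if "i < 11" "j < 11" for i j
    unfolding variation_def using that by (subst (2) sum.reindex_bij_betw[OF \<tau>(1), symmetric]) (simp add: eq)
  then show ?thesis using R lt \<sigma>(2) \<tau>(2) by (simp add: near_solution_def)
qed

text \<open>Conjugating the entries conjugates the first order terms, since \<open>R\<close> is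
  real, and preserves their moduli.\<close>

lemma near_solution_conj:
  assumes R: "near_solution c \<rho> y R" and \<tau>: "bij_betw \<tau> {..<11} {..<11}" "\<tau> 0 = 0"
    and eq: "\<And>i k. i < 11 \<Longrightarrow> k < 11 \<Longrightarrow> entry c i (\<tau> k) = cnj (entry c i k)"
  shows "near_solution c \<rho> y (\<lambda>i k. R i (\<tau> k))"
proof -
  have lt: "\<tau> i < 11" if "i < 11" for i
    using that \<tau> by (auto simp: bij_betw_def)
  have "variation (entry c) (\<lambda>i k. R i (\<tau> k)) i j = cnj (variation (entry c) R i j)" if "i < 11" "j < 11" for i j
    unfolding variation_def using that
    by (subst (2) sum.reindex_bij_betw[OF \<tau>(1), symmetric]) (simp add: eq)
  then show ?thesis using R lt \<tau>(2) by (simp add: near_solution_def)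
qed

text \<open>In row 1, flipping the columns alone reduces even columns to odd ones. Row 2 comes from
  row 1 by \<open>flip\<close>, the later rows by \<open>shift\<close>.\<close>

lemma near_solution_bound:
  assumes c: "approx_phases c" and R: "near_solution c \<rho> y R" and "p < 11" "q < 11"
  shows "\<bar>R p q\<bar> \<le> 3/10 * \<rho> + 10 * y"
proof -
  have shift0: "shift 0 = 0" and flip0: "flip 0 = 0" by (simp_all add: shift_def flip_def)
  have row1: "\<bar>R 1 q\<bar> \<le> 3/10 * \<rho> + 10 * y" if "near_solution c \<rho> y R" "q \<in> {1..<11}" for R q
  proof (cases "odd q")
    case True
    then have "q = 1 \<or> q = 3 \<or> q = 5 \<or> q = 7 \<or> q = 9"
      using that(2) unfolding atLeastLessThan_iff by presburger
    then have "q \<in> {1, 3, 5, 7, 9}" by blast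
    then show ?thesis by (rule near_solution_1q[OF c that(1)])
  next
    case False
    then have "q - 1 = 1 \<or> q - 1 = 3 \<or> q - 1 = 5 \<or> q - 1 = 7 \<or> q - 1 = 9"
      using that(2) unfolding atLeastLessThan_iff by presburger
    then have "q - 1 \<in> {1, 3, 5, 7, 9}" by blast
    moreover have "flip (q - 1) = q" using False that(2) by (auto simp: flip_def elim!: evenE)
    moreover have "near_solution c \<rho> y (\<lambda>i k. R i (flip k))"
      using that(1) bij_flip flip0 entry_flip_col by (rule near_solution_conj)
    ultimately show ?thesis using near_solution_1q[OF c, of \<rho> y "\<lambda>i k. R i (flip k)" "q - 1"] by simp
  qed
  have row2: "\<bar>R 2 q\<bar> \<le> 3/10 * \<rho> + 10 * y" if "near_solution c \<rho> y R" "q \<in> {1..<11}" for R q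
  proof -
    have "near_solution c \<rho> y (\<lambda>i k. R (flip i) (flip k))"
      using that(1) bij_flip flip0 bij_flip flip0 entry_flip by (rule near_solution_permute)
    moreover have "flip 1 = 2" "flip (flip q) = q" "flip q \<in> {1..<11}"
      using that(2) flip_flip[of q] flip0 by (auto simp: flip_def intro: ccontr)
    ultimately show ?thesis using row1[of "\<lambda>i k. R (flip i) (flip k)" "flip q"] by simp
  qed
  \<comment> \<open>\<open>R\<close> is quantified inside the induction because a symmetry replaces
    it by another perturbation.\<close>
  have up: "\<forall>q\<in>{1..<11}. \<forall>R. near_solution c \<rho> y R \<longrightarrow> \<bar>R (p + 2) q\<bar> \<le> 3/10 * \<rho> + 10 * y"
    if "\<forall>q\<in>{1..<11}. \<forall>R. near_solution c \<rho> y R \<longrightarrow> \<bar>R p q\<bar> \<le> 3/10 * \<rho> + 10 * y" "p \<in> {1..<9}" for p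
  proof (intro ballI allI impI)
    fix q :: nat and R assume q: "q \<in> {1..<11}" and R: "near_solution c \<rho> y R"
    have shifted: "near_solution c \<rho> y (\<lambda>i k. R (shift i) (shift k))"
      using R bij_shift shift0 bij_shift shift0 entry_shift by (rule near_solution_permute)
    have "q \<in> shift ` {..<11}" using q bij_shift by (simp add: bij_betw_def)
    then obtain q' where q': "q = shift q'" "q' < 11" by blast
    then have "q' \<in> {1..<11}" using q shift0 by (cases "q' = 0") auto
    from that(1)[rule_format, OF this shifted] have "\<bar>R (shift p) q\<bar> \<le> 3/10 * \<rho> + 10 * y"
      using q' by simp
    moreover have "shift p = p + 2" using that(2) by (simp add: shift_def)
    ultimately show "\<bar>R (p + 2) q\<bar> \<le> 3/10 * \<rho> + 10 * y" by simp
  qed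
  have bounds: "\<rho> \<ge> 0" "y \<ge> 0"
  proof -
    have "\<bar>R 1 1\<bar> \<le> \<rho>" "cmod (variation (entry c) R 0 0) \<le> y" using R by (auto simp: near_solution_def)
    then show "\<rho> \<ge> 0" "y \<ge> 0" using norm_ge_zero order_trans abs_ge_zero by blast+
  qed
  have all: "\<forall>q\<in>{1..<11}. \<forall>R. near_solution c \<rho> y R \<longrightarrow> \<bar>R p q\<bar> \<le> 3/10 * \<rho> + 10 * y"
  proof (rule all_shift_flip[where P = "\<lambda>p. \<forall>q\<in>{1..<11}. \<forall>R. near_solution c \<rho> y R \<longrightarrow>
      \<bar>R p q\<bar> \<le> 3/10 * \<rho> + 10 * y", OF _ _ _ _ \<open>p < 11\<close>])
    show "\<forall>q\<in>{1..<11}. \<forall>R. near_solution c \<rho> y R \<longrightarrow> \<bar>R 0 q\<bar> \<le> 3/10 * \<rho> + 10 * y"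
      using bounds by (simp add: near_solution_def)
  qed (use row1 row2 up in blast)+
  show ?thesis
  proof (cases "q = 0")
    case True
    then show ?thesis using R bounds by (simp add: near_solution_def)
  next
    case False
    then have "q \<in> {1..<11}" using \<open>q < 11\<close> by simp
    then show ?thesis using all R by blast
  qed
qed

section \<open>From first order rigidity to isolation\<close>

lemma norm_cis_minus_linear: "cmod (cis x - 1 - \<i> * of_real x) \<le> x\<^sup>2"
  \<comment> \<open>The argument is purely imaginary, so the exponential factor in the Taylor
    remainder is 1.\<close>
  using Taylor_exp[of "\<i> * of_real x" 1] by (simp add: cis_conv_exp norm_mult algebra_simps power2_eq_square)

text \<open>Let \<rho> be the largest modulus in \<open>R\<close>. Eleven Taylor remainders of size
  \<open>(2 * \<rho>)\<^sup>2\<close> bound the first order terms, so \<rho> is at most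
  \<open>3/10 * \<rho> + 440 * \<rho>\<^sup>2\<close>, and for \<rho> up to 1/1000 this is at most
  74/100 of \<rho>.\<close>

lemma phase_rigidity:
  assumes c: "approx_phases c"
    and orth: "\<And>i j. i < 11 \<Longrightarrow> j < 11 \<Longrightarrow> i \<noteq> j \<Longrightarrow> (\<Sum>k<11. entry c i k * cnj (entry c j k)) = 0"
    and R: "\<And>i k. i < 11 \<Longrightarrow> k < 11 \<Longrightarrow> \<bar>R i k\<bar> \<le> 1/1000" "\<And>k. R 0 k = 0" "\<And>i. R i 0 = 0"
    and orth': "\<And>i j. i < 11 \<Longrightarrow> j < 11 \<Longrightarrow> i \<noteq> j \<Longrightarrow>
      (\<Sum>k<11. entry c i k * cnj (entry c j k) * cis (R i k - R j k)) = 0"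
    and "i < 11" "k < 11"
  shows "R i k = 0"
proof -
  let ?A = "(\<lambda>(i, k). \<bar>R i k\<bar>) ` ({..<11} \<times> {..<11})"
  define \<rho> where "\<rho> = Max ?A"
  have "(0, 0) \<in> {..<11::nat} \<times> {..<11::nat}" by simp
  then have fin: "finite ?A" and "?A \<noteq> {}" by (simp, blast)
  then have "\<rho> \<in> ?A" unfolding \<rho>_def by (rule Max_in)
  then obtain p q where pq: "p < 11" "q < 11" "\<rho> = \<bar>R p q\<bar>" by auto
  have le: "\<bar>R i k\<bar> \<le> \<rho>" if "i < 11" "k < 11" for i k
    unfolding \<rho>_def using fin that by (intro Max_ge) auto
  have \<rho>: "0 \<le> \<rho>" "\<rho> \<le> 1/1000" using pq R(1) by auto
  have "cmod (variation (entry c) R i j) \<le> 44 * \<rho>\<^sup>2" if ij: "i < 11" "j < 11" for i j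
  proof (cases "i = j")
    case True
    then show ?thesis by (simp add: variation_def)
  next
    case False
    let ?h = "\<lambda>k. entry c i k * cnj (entry c j k)"
    let ?\<theta> = "\<lambda>k. R i k - R j k"
    \<comment> \<open>Both inner products vanish, so inserting them leaves only the Taylor
      remainders.\<close>
    have "\<i> * variation (entry c) R i j = (\<Sum>k<11. ?h k) + (\<Sum>k<11. ?h k * (\<i> * of_real (?\<theta> k))) - (\<Sum>k<11. ?h k * cis (?\<theta> k))"
      using orth[OF ij False] orth'[OF ij False] by (simp add: variation_def sum_distrib_left mult_ac)
    also have "\<dots> = - (\<Sum>k<11. ?h k * (cis (?\<theta> k) - 1 - \<i> * of_real (?\<theta> k)))"
      by (simp only: right_diff_distrib sum_subtractf) simp
    finally have "cmod (\<i> * variation (entry c) R i j) = cmod (\<Sum>k<11. ?h k * (cis (?\<theta> k) - 1 - \<i> * of_real (?\<theta> k)))"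
      by (simp only: norm_minus_cancel)
    also have "\<dots> \<le> (\<Sum>k<(11::nat). 4 * \<rho>\<^sup>2)"
    proof (rule sum_norm_le)
      fix k :: nat assume "k \<in> {..<11}"
      then have "\<bar>?\<theta> k\<bar> \<le> \<bar>2 * \<rho>\<bar>" using le[of i k] le[of j k] ij \<rho>(1) by simp
      then have "(?\<theta> k)\<^sup>2 \<le> 4 * \<rho>\<^sup>2" by (simp only: abs_le_square_iff) (simp add: power2_eq_square)
      then show "cmod (?h k * (cis (?\<theta> k) - 1 - \<i> * of_real (?\<theta> k))) \<le> 4 * \<rho>\<^sup>2"
        using norm_cis_minus_linear[of "?\<theta> k"] by (simp only: norm_mult complex_mod_cnj norm_entry[OF c])
    qed
    finally show ?thesis by (simp add: norm_mult)
  qed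
  then have "near_solution c \<rho> (44 * \<rho>\<^sup>2) R"
    using le R by (simp add: near_solution_def)
  from near_solution_bound[OF c this pq(1,2)] have "\<rho> \<le> 3/10 * \<rho> + 440 * \<rho>\<^sup>2"
    using pq(3) by simp
  also have "440 * \<rho>\<^sup>2 \<le> 440 * (1/1000) * \<rho>"
    using mult_right_mono[OF \<rho>(2,1)] by (simp add: power2_eq_square)
  finally have "\<rho> \<le> 0" by simp
  then show ?thesis using le[OF assms(7,8)] by simp
qed

lemma diagonal_unitaryI:
  assumes "\<And>r. cmod (d r) = 1"
  shows "diagonal_unitary (\<chi> r s. if r = s then d r else 0)"
proof -
  have "d r * cnj (d r) = 1" for r using assms[of r] complex_norm_square[of "d r"] by simp
  then show ?thesis
    unfolding diagonal_unitary_def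
    by (auto simp: vec_eq_iff matrix_matrix_mult_def conj_transpose_def map_matrix_def transpose_def mat_def
        if_distrib[where f="\<lambda>x. _ * x"] if_distrib[where f="\<lambda>x. x * _"] if_distrib[where f=cnj] mult.commute cong: if_cong)
qed

lemma permutation_matrix_id: "permutation_matrix (mat 1)"
  unfolding permutation_matrix_def by (intro exI[of _ id]) (auto simp: permutes_id mat_def vec_eq_iff)

lemma hadamard_equivalent_scaleI:
  fixes H K :: "complex^'n^'n"
  assumes "\<And>r. cmod (d r) = 1" "\<And>s. cmod (e s) = 1" "\<And>r s. K $ r $ s = d r * H $ r $ s * e s"
  shows "hadamard_equivalent K H"
proof -
  have "K = (\<chi> r s. if r = s then d r else 0) ** mat 1 ** H ** mat 1 ** (\<chi> r s. if r = s then e r else 0)"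
    unfolding matrix_mul_rid by (simp add: vec_eq_iff matrix_matrix_mult_def assms(3)
        if_distrib[where f="\<lambda>x. _ * x"] if_distrib[where f="\<lambda>x. x * _"] cong: if_cong)
  then show ?thesis
    unfolding hadamard_equivalent_def
    using diagonal_unitaryI[of d] diagonal_unitaryI[of e] assms(1,2) permutation_matrix_id by blast
qed

theorem isolated_L11:
  assumes c: "approx_phases c" and hadamard: "complex_hadamard (L11 c)"
  shows "isolated_hadamard (L11 c)"
proof -
  have "continuous (at 1) Arg" by (intro continuous_at_Arg) (auto simp: complex_nonpos_Reals_iff)
  then obtain e where e: "e > 0" "\<And>w. cmod (w - 1) < e \<Longrightarrow> \<bar>Arg w\<bar> < 1/1000"
    unfolding continuous_at_eps_delta dist_norm by (metis Arg_1 diff_zero divide_pos_pos real_norm_def zero_less_numeral zero_less_one)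
  have orth: "(\<Sum>k<11. entry c i k * cnj (entry c j k)) = 0" if "i < 11" "j < 11" "i \<noteq> j" for i j
    using hadamard that unfolding complex_hadamard_iff[of "L11 c", OF L11_entry] by simp
  have h0: "entry c i 0 = 1" "entry c 0 k = 1" for i k by (simp_all add: entry_def letter_index_def letter_def)
  \<comment> \<open>\<open>w\<close> below is a product of four numbers, each within
    \<open>e / 5\<close> of 1, so this radius keeps it within \<open>e\<close> of 1.\<close>
  have "hadamard_equivalent K (L11 c)" if K: "K \<in> ball (L11 c) (e / 5)" "complex_hadamard K" for K
  proof -
    define \<kappa> where "\<kappa> i k = K $ (of_nat i) $ (of_nat k)" for i k
    have of_nat_pos: "of_nat (pos r) = r" for r :: 11
      using bij_betw_pos pos_of_nat by (metis bij_betw_def inj_onD lessThan_iff rangeI UNIV_I)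
    have \<kappa>: "K $ r $ s = \<kappa> (pos r) (pos s)" for r s by (simp add: \<kappa>_def of_nat_pos)
    note K_had = K(2)[unfolded complex_hadamard_iff[of K, OF \<kappa>]]
    have norm_\<kappa>: "cmod (\<kappa> i k) = 1" if "i < 11" "k < 11" for i k using K_had that by blast
    have near: "cmod (\<kappa> i k - entry c i k) < e / 5" if "i < 11" "k < 11" for i k
    proof -
      have "cmod (\<kappa> i k - entry c i k) = cmod ((K - L11 c) $ of_nat i $ of_nat k)"
        using that by (simp add: \<kappa>_def L11_entry pos_of_nat)
      also have "\<dots> \<le> norm (K - L11 c)" 
        using Finite_Cartesian_Product.norm_nth_le[of "(K - L11 c) $ of_nat i" "of_nat k"]
          Finite_Cartesian_Product.norm_nth_le[of "K - L11 c" "of_nat i"] by linarith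
      also have "\<dots> < e / 5" using K(1) by (simp add: dist_norm norm_minus_commute)
      finally show ?thesis .
    qed
    \<comment> \<open>The dephased entry of \<open>K\<close> divided by the entry of
      \<open>L11 c\<close>; conjugates invert unimodular numbers. It equals 1 on row 0 and column
      0.\<close>
    define w where "w i k = \<kappa> i k * cnj (entry c i k) * cnj (\<kappa> i 0) * cnj (\<kappa> 0 k) * \<kappa> 0 0" for i k
    define R where "R i k = (if i < 11 \<and> k < 11 then Arg (w i k) else 0)" for i k
    have norm_w: "cmod (w i k) = 1" if "i < 11" "k < 11" for i k
      using that by (simp add: w_def norm_mult norm_\<kappa> norm_entry[OF c])
    have cis_R: "cis (R i k) = w i k" if "i < 11" "k < 11" for i k
    proof -
      have "w i k \<noteq> 0" using norm_w[OF that] by auto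
      then show ?thesis using that norm_w[OF that] by (simp add: R_def cis_Arg sgn_eq)
    qed
    have unit: "x * cnj x = 1" if "cmod x = 1" for x using that complex_norm_square[of x] by simp
    have "cmod (w i k - 1) < e" if ik: "i < 11" "k < 11" for i k
    proof -
      have prod: "cmod (x * y - 1) \<le> cmod (x - 1) + cmod (y - 1)" if "cmod y = 1" for x y
      proof -
        have eq: "x * y - 1 = (x - 1) * y + (y - 1)" by (simp add: algebra_simps)
        show ?thesis unfolding eq using norm_triangle_ineq[of "(x - 1) * y" "y - 1"] that
          by (simp only: norm_mult mult_1_right)
      qed
      have cnj1: "cmod (cnj x - 1) = cmod (x - 1)" for x
        using complex_mod_cnj[of "x - 1"] by simp
      have "\<kappa> i k * cnj (entry c i k) - 1 = (\<kappa> i k - entry c i k) * cnj (entry c i k)"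
        using unit[OF norm_entry[OF c]] by (simp add: algebra_simps)
      then have "cmod (\<kappa> i k * cnj (entry c i k) - 1) < e / 5"
        using near[OF ik] by (simp add: norm_mult norm_entry[OF c])
      moreover have "cmod (cnj (\<kappa> i 0) - 1) < e / 5" "cmod (cnj (\<kappa> 0 k) - 1) < e / 5" "cmod (\<kappa> 0 0 - 1) < e / 5"
        using near[of i 0] near[of 0 k] near[of 0 0] ik h0 cnj1[of "\<kappa> i 0"] cnj1[of "\<kappa> 0 k"] by simp_all
      moreover have "cmod (w i k - 1) \<le> cmod (\<kappa> i k * cnj (entry c i k) - 1) + cmod (cnj (\<kappa> i 0) - 1) + cmod (cnj (\<kappa> 0 k) - 1) + cmod (\<kappa> 0 0 - 1)"
        using prod[OF norm_\<kappa>[of 0 0], of "\<kappa> i k * cnj (entry c i k) * cnj (\<kappa> i 0) * cnj (\<kappa> 0 k)"]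
          prod[of "cnj (\<kappa> 0 k)" "\<kappa> i k * cnj (entry c i k) * cnj (\<kappa> i 0)"]
          prod[of "cnj (\<kappa> i 0)" "\<kappa> i k * cnj (entry c i k)"] norm_\<kappa>[of 0 k] norm_\<kappa>[of i 0] ik
        by (simp add: w_def)
      ultimately show ?thesis using e(1) by linarith
    qed
    then have R_small: "\<bar>R i k\<bar> \<le> 1/1000" if "i < 11" "k < 11" for i k
      using e(2)[of "w i k"] that by (simp add: R_def less_imp_le)
    have "w 0 k = 1" "w k 0 = 1" if "k < 11" for k
    proof -
      have "w 0 k = (\<kappa> 0 0 * cnj (\<kappa> 0 0)) * (\<kappa> 0 k * cnj (\<kappa> 0 k))"
        "w k 0 = (\<kappa> 0 0 * cnj (\<kappa> 0 0)) * (\<kappa> k 0 * cnj (\<kappa> k 0))"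
        by (simp_all add: w_def h0 mult_ac)
      then show "w 0 k = 1" "w k 0 = 1"
        using that by (simp_all add: unit norm_\<kappa>)
    qed
    then have R0: "R 0 k = 0" "R k 0 = 0" for k
      by (simp_all add: R_def)
    have "(\<Sum>k<11. entry c i k * cnj (entry c j k) * cis (R i k - R j k)) = 0" if ij: "i < 11" "j < 11" "i \<noteq> j" for i j
    proof -
      \<comment> \<open>After cancelling unimodular factors each term is that of \<open>K\<close>
        times a factor independent of \<open>k\<close>, so orthogonality of \<open>K\<close>
        applies.\<close>
      have "entry c i k * cnj (entry c j k) * cis (R i k - R j k) = \<kappa> i k * cnj (\<kappa> j k) * (cnj (\<kappa> i 0) * \<kappa> j 0)"
        if "k < 11" for k
      proof -
        have "cis (R i k - R j k) = w i k * cnj (w j k)"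
          unfolding cis_R[OF ij(1) that, symmetric] cis_R[OF ij(2) that, symmetric]
          by (simp add: complex_eq_iff cos_diff sin_diff)
        then have "entry c i k * cnj (entry c j k) * cis (R i k - R j k) =
            \<kappa> i k * cnj (\<kappa> j k) * (cnj (\<kappa> i 0) * \<kappa> j 0) * (entry c i k * cnj (entry c i k)) * (entry c j k * cnj (entry c j k)) *
              (\<kappa> 0 k * cnj (\<kappa> 0 k)) * (\<kappa> 0 0 * cnj (\<kappa> 0 0))"
          by (simp add: w_def mult_ac)
        then show ?thesis using that by (simp add: unit norm_entry[OF c] norm_\<kappa>)
      qed
      then have "(\<Sum>k<11. entry c i k * cnj (entry c j k) * cis (R i k - R j k)) =
          (\<Sum>k<11. \<kappa> i k * cnj (\<kappa> j k)) * (cnj (\<kappa> i 0) * \<kappa> j 0)"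
        by (simp add: sum_distrib_right)
      then show ?thesis using K_had ij by simp
    qed
    from phase_rigidity[OF c orth R_small R0 this] have "R i k = 0" if "i < 11" "k < 11" for i k
      using that by blast
    then have w1: "w i k = 1" if "i < 11" "k < 11" for i k
      using cis_R[OF that] that by simp
    \<comment> \<open>With \<open>w\<close> equal to 1, \<open>K\<close> arises from
      \<open>L11 c\<close> by rescaling rows and columns.\<close>
    have scaled: "\<kappa> i k = \<kappa> i 0 * entry c i k * (\<kappa> 0 k * cnj (\<kappa> 0 0))" if "i < 11" "k < 11" for i k
    proof -
      have "\<kappa> i 0 * entry c i k * (\<kappa> 0 k * cnj (\<kappa> 0 0)) = \<kappa> i 0 * entry c i k * (\<kappa> 0 k * cnj (\<kappa> 0 0)) * w i k"
        using w1[OF that] by simp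
      also have "\<dots> = \<kappa> i k * (\<kappa> i 0 * cnj (\<kappa> i 0)) * (entry c i k * cnj (entry c i k)) * (\<kappa> 0 k * cnj (\<kappa> 0 k)) * (\<kappa> 0 0 * cnj (\<kappa> 0 0))"
        by (simp add: w_def mult_ac)
      finally show ?thesis using that by (simp add: unit norm_entry[OF c] norm_\<kappa>)
    qed
    have lt: "pos r < 11" for r using bij_betw_pos by (auto simp: bij_betw_def)
    show ?thesis
    proof (rule hadamard_equivalent_scaleI)
      show "cmod (\<kappa> (pos r) 0) = 1" "cmod (\<kappa> 0 (pos s) * cnj (\<kappa> 0 0)) = 1" for r s
        using lt by (simp_all add: norm_mult norm_\<kappa>)
      show "K $ r $ s = \<kappa> (pos r) 0 * L11 c $ r $ s * (\<kappa> 0 (pos s) * cnj (\<kappa> 0 0))" for r s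
        unfolding \<kappa>[of r s] L11_entry by (rule scaled[OF lt lt])
    qed
  qed
  then show ?thesis
    unfolding isolated_hadamard_def using hadamard e(1) by (intro conjI exI[of _ "ball (L11 c) (e / 5)"]) auto
qed

section \<open>Not of Butson type\<close>

text \<open>The \<open>c\<^sub>j\<close> multiplied by \<open>10^4\<close> and rounded towards 0, so that these points lie in the unit disc.\<close>

definition phases :: "gauss_int list" where
  "phases = [(-9224, -3860), (-714, -9974), (-6203, 7843), (9978, -659), (1163, -9932)]"

fun zmult :: "gauss_int \<Rightarrow> gauss_int \<Rightarrow> gauss_int" where
  "zmult (a, b) (x, y) = (a * x - b * y, a * y + b * x)"

fun zpow :: "gauss_int \<Rightarrow> nat \<Rightarrow> gauss_int" where
  "zpow z 0 = (1, 0)"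
| "zpow z (Suc n) = zmult z (zpow z n)"

lemma gauss_zpow: "gauss (zpow z n) = gauss z ^ n"
proof -
  have "gauss (zmult z w) = gauss z * gauss w" for z w
    by (cases z; cases w) (simp add: gauss_def complex_eq_iff)
  then show ?thesis by (induction n) (simp_all, simp add: gauss_def complex_eq_iff)
qed

text \<open>Cleared of denominators: the power of the approximate phase differs from 1 by more than
  \<open>6 * n / 10000\<close> in the sum norm.\<close>

definition power_apart :: "nat \<Rightarrow> nat \<Rightarrow> bool" where
  "power_apart n j \<longleftrightarrow> (let (x, y) = zpow (phases ! j) n in
     6 * int n * 10000 ^ n < 10000 * (\<bar>x - 10000 ^ n\<bar> + \<bar>y\<bar>))"

text \<open>The exponents \<open>14 = 2 * 7\<close> and \<open>22 = 2 * 11\<close> come from large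
  prime factors of the order; 30 is the exponent left without them.\<close>

lemma powers_apart: "list_all (power_apart 14) [0..<5] \<and> list_all (power_apart 22) [0..<5] \<and> power_apart 30 0"
  by code_simp

text \<open>Rounding and enclosure together put \<open>c j\<close> within 3/10000 of
  \<open>w\<close>. In the unit disc the \<open>n\<close>-th powers then differ by at most
  \<open>n * (3/10000)\<close>, and the sum norm is at most twice the modulus.\<close>

lemma power_apartD:
  assumes c: "approx_phases c" and j: "j < 5" and ap: "power_apart n j"
  shows "c j ^ n \<noteq> 1"
proof
  assume eq: "c j ^ n = 1"
  define w where "w = gauss (phases ! j) / 10000"
  have "\<forall>j<5. \<bar>a0 j / 2 - Re (gauss (phases ! j) / 10000)\<bar> \<le> 1/10000 \<and> \<bar>b0 j / 2 - Im (gauss (phases ! j) / 10000)\<bar> \<le> 1/10000 \<and>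
      cmod (gauss (phases ! j) / 10000) \<le> 1"
    unfolding all_lt5 by (simp add: phases_def gauss_def a0_def b0_def cmod_def norm_divide power_divide)
  then have w: "\<bar>a0 j / 2 - Re w\<bar> \<le> 1/10000" "\<bar>b0 j / 2 - Im w\<bar> \<le> 1/10000" "cmod w \<le> 1"
    using j by (auto simp: w_def)
  have cj: "cmod (c j) = 1" "\<bar>2 * Re (c j) - a0 j\<bar> \<le> 1/10000" "\<bar>2 * Im (c j) - b0 j\<bar> \<le> 1/10000"
    using c j by (auto simp: approx_phases_def)
  have "cmod (c j - w) \<le> 3/10000"
    using w(1,2) cj(2,3) cmod_le[of "c j - w"] unfolding minus_complex.sel by linarith
  then have bound: "cmod (1 - w ^ n) \<le> n * (3/10000)"
    using norm_power_diff[of "c j" w n] w(3) cj(1) eq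
    by (smt (verit) mult_left_mono of_nat_0_le_iff)
  have wn: "w ^ n = gauss (zpow (phases ! j) n) / 10000 ^ n"
    by (simp add: w_def gauss_zpow power_divide)
  obtain x y where xy: "zpow (phases ! j) n = (x, y)" by (cases "zpow (phases ! j) n")
  have "\<bar>Re (w ^ n) - 1\<bar> + \<bar>Im (w ^ n)\<bar> \<le> 2 * cmod (1 - w ^ n)"
    using abs_Re_le_cmod[of "1 - w ^ n"] abs_Im_le_cmod[of "1 - w ^ n"] by simp
  moreover have "Re (w ^ n) = x / 10000 ^ n" "Im (w ^ n) = y / 10000 ^ n"
    unfolding wn xy gauss_def by (simp_all add: Re_divide_of_real[of _ "10000 ^ n", simplified] Im_divide_of_real[of _ "10000 ^ n", simplified])
  ultimately have "\<bar>x / 10000 ^ n - 1\<bar> + \<bar>y / 10000 ^ n\<bar> \<le> 2 * cmod (1 - w ^ n)"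
    by (simp only:)
  also have "\<dots> \<le> n * (6/10000)"
    using bound by simp
  finally have "\<bar>x / 10000 ^ n - 1\<bar> + \<bar>y / 10000 ^ n\<bar> \<le> n * (6/10000)" .
  moreover define D :: real where "D = 10000 ^ n"
  ultimately have "(\<bar>x / D - 1\<bar> + \<bar>y / D\<bar>) * D \<le> n * (6/10000) * D"
    by (intro mult_right_mono) auto
  moreover have D: "D > 0" by (simp add: D_def)
  then have "(\<bar>x / D - 1\<bar> + \<bar>y / D\<bar>) * D = \<bar>(x / D - 1) * D\<bar> + \<bar>y / D * D\<bar>"
    by (simp only: distrib_right abs_mult abs_of_pos)
  moreover have "(x / D - 1) * D = x - D" "y / D * D = y"
    using D by (simp_all add: left_diff_distrib)
  ultimately have "10000 * (\<bar>x - D\<bar> + \<bar>real_of_int y\<bar>) \<le> 6 * real n * D"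
    by simp
  then have "real_of_int (10000 * (\<bar>x - 10000 ^ n\<bar> + \<bar>y\<bar>)) \<le> real_of_int (6 * int n * 10000 ^ n)"
    by (simp add: D_def)
  then show False using ap unfolding power_apart_def xy by (simp only: of_int_le_iff prod.case Let_def)
qed

text \<open>Among the 32 subsets only the full one brings the approximate sum within 1/2000 of 0,
  which is the total error of five enclosures.\<close>

lemma subset_sum_nonzero:
  assumes c: "approx_phases c" and P: "1 + (\<Sum>j<5. if P j then 2 * Re (c j) else 0) = 0" and "j < 5"
  shows "P j"
proof -
  have "\<bar>(\<Sum>j<5. if P j then 2 * Re (c j) else 0) - (\<Sum>j<5. if P j then a0 j else 0)\<bar> \<le> (\<Sum>j<(5::nat). 1/10000)"
    unfolding sum_subtractf[symmetric] using c
    by (intro order_trans[OF sum_abs] sum_mono) (simp add: approx_phases_def)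
  also have "\<dots> = 1/2000" by simp
  finally have "\<bar>1 + (\<Sum>j<5. if P j then a0 j else 0)\<bar> \<le> 1/2000"
    using P by linarith
  then have "\<forall>j<5. P j"
    unfolding all_lt5 sum_lt5 a0_def
    by (cases "P 0"; cases "P 1"; cases "P 2"; cases "P 3"; cases "P 4"; simp)
  then show ?thesis using \<open>j < 5\<close> by blast
qed

lemma not_butson_L11:
  assumes c: "approx_phases c" and sum: "(\<Sum>j<5. 2 * Re (c j)) = - 1"
  shows "\<not> butson_type (L11 c)"
proof
  assume "butson_type (L11 c)"
  then obtain q0 :: nat where q0: "q0 > 0" "\<And>r s. (L11 c $ r $ s) ^ q0 = 1"
    by (auto simp: butson_type_def)
  have norm: "cmod (c j) = 1" if "j < 5" for j using c that by (simp add: approx_phases_def)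
  have "c j ^ q0 = 1" if "j < 5" for j
  proof -
    have "letter_index 1 (2 * j + 1) = 2 * j + 1" using that by (simp add: letter_index_def)
    then have "entry c 1 (2 * j + 1) = c j" by (simp add: entry_def letter_def)
    then have "L11 c $ of_nat 1 $ of_nat (2 * j + 1) = c j"
      unfolding L11_entry using that by (simp only: pos_of_nat)
    then show ?thesis using q0(2) by metis
  qed
  then have ex: "q0 > 0 \<and> (\<forall>j<5. c j ^ q0 = 1)" using q0(1) by blast
  \<comment> \<open>For the least common exponent, raising to the power \<open>q div p\<close> with
    \<open>p\<close> a prime factor cannot send every \<open>c j\<close> to 1.\<close>
  define q where "q = (LEAST q. q > 0 \<and> (\<forall>j<5. c j ^ q = 1))"
  have q: "q > 0" "\<And>j. j < 5 \<Longrightarrow> c j ^ q = 1"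
    using LeastI[of "\<lambda>q. q > 0 \<and> (\<forall>j<5. c j ^ q = 1)", OF ex] by (auto simp: q_def)
  have minimal: "\<exists>j<5. c j ^ m \<noteq> 1" if "0 < m" "m < q" for m
    using not_less_Least[of m "\<lambda>q. q > 0 \<and> (\<forall>j<5. c j ^ q = 1)"] that by (auto simp: q_def)
  let ?I = "{..<11::nat}"
  have letter0: "letter c 0 = 1" and letter_c: "letter c (2 * j + 1) = c j" "letter c (2 * j + 2) = cnj (c j)" for j
    by (simp_all add: letter_def)
  have index: "i = 0 \<or> (\<exists>j<5. i = 2 * j + 1 \<or> i = 2 * j + 2)" if "i < 11" for i :: nat
    using that by presburger
  have split: "(\<Sum>i<11. f i) = f 0 + (\<Sum>j<5. f (2 * j + 1) + f (2 * j + 2))" for f :: "nat \<Rightarrow> complex"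
    by (simp add: eval_nat_numeral add_ac)
  have cnj_power: "cnj z ^ n = 1 \<longleftrightarrow> z ^ n = 1" for z n
    by (metis complex_cnj_cnj complex_cnj_one complex_cnj_power)
  have root: "letter c i ^ q = 1" if "i \<in> ?I" for i
    using index[of i] that q(2) letter0 letter_c cnj_power by (metis lessThan_iff power_one)
  have add_cnj: "z + cnj z = of_real (2 * Re z)" for z by (simp add: complex_eq_iff)
  have zero: "(\<Sum>i\<in>?I. letter c i) = 0"
    unfolding split letter0 letter_c add_cnj of_real_sum[symmetric] sum by simp
  \<comment> \<open>If \<open>W\<close> were 0, the class \<open>e = 1\<close>, which contains the
    letter 0 and is closed under conjugation, would have sum 0. Then
    \<open>subset_sum_nonzero\<close> forces \<open>c j ^ (q div p) = 1\<close> for all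
    \<open>j\<close>, against minimality.\<close>
  have sums: thesis
    if p: "prime p" "p dvd q" and *: "\<And>W v0. W \<noteq> 0 \<Longrightarrow> \<not> p dvd q div p \<Longrightarrow>
      (\<And>e. e ^ p = 1 \<Longrightarrow> of_nat p * (\<Sum>i | i \<in> ?I \<and> letter c i ^ (q div p) = e. letter c i) * e ^ v0 = W) \<Longrightarrow> thesis"
    for p thesis
  proof -
    obtain W v0 where W: "\<And>e. e ^ p = 1 \<Longrightarrow> of_nat p * (\<Sum>i | i \<in> ?I \<and> letter c i ^ (q div p) = e. letter c i) * e ^ v0 = W"
      "p dvd q div p \<Longrightarrow> W = 0"
      using class_sums[OF _ q(1) root zero p] by blast
    have "W \<noteq> 0"
    proof
      assume "W = 0"
      define m where "m = q div p"
      have m: "0 < m" "m < q"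
        using p q(1) prime_gt_1_nat[OF p(1)] by (auto simp: m_def div_greater_zero_iff dvd_imp_le prime_gt_0_nat)
      have "(\<Sum>i | i \<in> ?I \<and> letter c i ^ m = 1. letter c i) = 0"
        using W(1)[of 1] \<open>W = 0\<close> prime_gt_0_nat[OF p(1)] by (simp add: m_def)
      then have "(\<Sum>i<11. if letter c i ^ m = 1 then letter c i else 0) = 0"
        by (simp only: sum.inter_filter[OF finite_lessThan])
      then have "1 + (\<Sum>j<5. if c j ^ m = 1 then c j + cnj (c j) else 0) = 0"
        unfolding split letter0 letter_c cnj_power by (simp add: if_distrib[where f="\<lambda>x. x + _"] cong: if_cong)
      then have "of_real (1 + (\<Sum>j<5. if c j ^ m = 1 then 2 * Re (c j) else 0)) = (0 :: complex)"
        by (simp add: add_cnj if_distrib[of of_real] cong: if_cong)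
      then have "1 + (\<Sum>j<5. if c j ^ m = 1 then 2 * Re (c j) else 0) = 0"
        by (simp only: of_real_eq_0_iff)
      from subset_sum_nonzero[OF c this] minimal[OF m] show False by blast
    qed
    then show thesis using * W by blast
  qed
  have small: "p < 7" if p: "prime p" "p dvd q" for p
  proof (rule ccontr)
    assume "\<not> p < 7"
    define m where "m = q div p"
    obtain W v0 where "W \<noteq> 0" and W: "\<And>e. e ^ p = 1 \<Longrightarrow> of_nat p * (\<Sum>i | i \<in> ?I \<and> letter c i ^ m = e. letter c i) * e ^ v0 = W"
      using sums[OF p] unfolding m_def by metis
    have p0: "p > 0" using p(1) by (rule prime_gt_0_nat)
    have qm: "q = m * p" using p by (simp add: m_def)
    \<comment> \<open>The class of 1 is left out since it contains the letter 0; the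
      \<open>p - 1\<close> others are nonempty and share ten letters.\<close>
    define E where "E = {e::complex. e ^ p = 1} - {1}"
    define A where "A e = {i \<in> {1..<11}. letter c i ^ m = e}" for e
    have A: "{i. i \<in> ?I \<and> letter c i ^ m = e} = A e" if "e \<in> E" for e
      using that by (auto simp: A_def E_def letter0 intro: ccontr) (metis One_nat_def Suc_leI gr0I power_one letter0)
    have nonempty: "A e \<noteq> {}" if "e \<in> E" for e
      using W[of e] A[OF that] \<open>W \<noteq> 0\<close> that by (auto simp: E_def)
    have finE: "finite E" and cardE: "card E = p - 1"
      using p0 finite_roots_unity[of p] card_roots_unity_eq[of p] by (auto simp: E_def card_Diff_singleton)
    have "(\<Sum>e\<in>E. card (A e)) = card (\<Union>e\<in>E. A e)"
      by (subst card_UN_disjoint) (auto simp: finE A_def)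
    also have "\<dots> \<le> card {1..<11::nat}"
      by (intro card_mono) (auto simp: A_def)
    finally have total: "(\<Sum>e\<in>E. card (A e)) \<le> 10" by simp
    have pos_card: "card (A e) \<ge> 1" if "e \<in> E" for e
      using nonempty[OF that] by (simp add: A_def Suc_le_eq card_gt_0_iff)
    have "card E \<le> 10"
      using sum_bounded_below[of E 1 "\<lambda>e. card (A e)"] pos_card total by simp
    then have p_le: "p \<le> 11" using cardE by simp
    \<comment> \<open>For \<open>p\<close> at least 7 there are at least six classes for ten
      letters, so one is a singleton.\<close>
    obtain e where e: "e \<in> E" "card (A e) = 1"
    proof (rule ccontr)
      assume "\<not> thesis"
      then have "card (A e) \<ge> 2" if "e \<in> E" for e
        using that pos_card[of e] \<open>\<And>e. e \<in> E \<Longrightarrow> card (A e) = 1 \<Longrightarrow> thesis\<close> by (metis One_nat_def Suc_1 le_antisym not_less_eq_eq)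
      then have "card E * 2 \<le> 10"
        using sum_bounded_below[of E 2 "\<lambda>e. card (A e)"] total by simp
      then show False using cardE \<open>\<not> p < 7\<close> by simp
    qed
    then obtain i where i: "A e = {i}" by (auto simp: card_1_singleton_iff)
    then have "i \<in> A e" by simp
    then have i11: "0 < i" "i < 11" and ie: "letter c i ^ m = e" by (auto simp: A_def)
    have ep: "e ^ p = 1" using e(1) by (simp add: E_def)
    have ec: "cnj e ^ p = 1" using ep by (metis complex_cnj_one complex_cnj_power)
    have "cnj e \<in> E" using e(1) ec by (auto simp: E_def)
    \<comment> \<open>Conjugation carries the class of \<open>e\<close> to that of
      \<open>cnj e\<close>, which is therefore a singleton as well.\<close>
    have "A (cnj e) = {flip i}"
    proof -
      have flip_range: "flip k \<in> {1..<11}" if "k \<in> {1..<11}" for k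
        using flip_flip[of k] that by (auto simp: flip_def)
      have mem: "flip k \<in> A (cnj e')" if "k \<in> A e'" for k e'
        using that flip_range[of k] by (auto simp: A_def letter_flip simp flip: complex_cnj_power)
      have "k = flip i" if "k \<in> A (cnj e)" for k
      proof -
        have "flip k \<in> A e" using mem[OF that] by simp
        then have "flip k = i" unfolding i by simp
        moreover have "k < 11" using that by (simp add: A_def)
        ultimately show ?thesis using flip_flip[of k] by simp
      qed
      then show ?thesis using mem[OF \<open>i \<in> A e\<close>] by blast
    qed
    \<comment> \<open>Both classes have the same weighted sum \<open>W\<close>; taking
      \<open>p\<close>-th powers then removes \<open>e\<close>.\<close>
    have "of_nat p * letter c i * e ^ v0 = of_nat p * cnj (letter c i) * cnj e ^ v0"
      using W[OF ep] W[OF ec] A[OF e(1)] A[OF \<open>cnj e \<in> E\<close>] i \<open>A (cnj e) = {flip i}\<close> by (simp add: letter_flip)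
    then have "letter c i * e ^ v0 = cnj (letter c i) * cnj e ^ v0" using p0 by simp
    then have "(letter c i * e ^ v0) ^ p = (cnj (letter c i) * cnj e ^ v0) ^ p" by simp
    then have "letter c i ^ p = cnj (letter c i) ^ p"
      using ep ec by (simp add: power_mult_distrib) (metis (no_types, lifting) mult.commute mult.right_neutral power_mult power_one)
    moreover have "letter c i * cnj (letter c i) = 1"
      using norm_letter[OF c i11(2)] complex_norm_square[of "letter c i"] by simp
    ultimately have "letter c i ^ (2 * p) = 1"
      by (metis mult_2 power_add power_mult_distrib power_one)
    moreover obtain j where j: "j < 5" "i = 2 * j + 1 \<or> i = 2 * j + 2"
      using index[OF i11(2)] i11(1) by auto
    ultimately have cj: "c j ^ (2 * p) = 1"
      using letter_c by (metis complex_cnj_cnj complex_cnj_one complex_cnj_power)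
    have "p = 7 \<or> p = 8 \<or> p = 9 \<or> p = 10 \<or> p = 11" using p_le \<open>\<not> p < 7\<close> by linarith
    then have "p = 7 \<or> p = 11" using p(1) prime_product[of 2 4] prime_product[of 3 3] prime_product[of 2 5] by auto
    then show False
      using cj power_apartD[OF c j(1)] powers_apart j(1) by (auto simp: list_all_iff)
  qed
  \<comment> \<open>A nonzero \<open>W\<close> for each prime factor makes \<open>q\<close>
    squarefree.\<close>
  have "q dvd 30"
    using q(1) small sums by (intro dvd_30I) metis+
  then obtain k where "30 = q * k" by (elim dvdE)
  then have "c 0 ^ 30 = 1" using q(2)[of 0] by (simp only: power_mult) simp
  then show False using power_apartD[OF c, of 0 30] powers_apart by simp
qed

section \<open>Back to the angle equations\<close>

theorem proposition3:
  shows "\<exists>\<alpha> :: nat \<Rightarrow> real.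
    (\<Sum>j<5. cos (\<alpha> j)) = - 1/2 \<and>
    (\<Sum>j<5. cos (2 * \<alpha> j)) = - 1/2 \<and>
    (\<forall>i\<in>{0, 1}. (\<Sum>j<5. cos (\<alpha> j + \<alpha> ((j + 1 + i) mod 5))) = - 1/2) \<and>
    (\<forall>i\<in>{0, 1}. (\<Sum>j<5. cos (\<alpha> j - \<alpha> ((j + 1 + i) mod 5))) = - 1/2) \<and>
    complex_hadamard (L11 (\<lambda>j. cis (\<alpha> j))) \<and>
    isolated_hadamard (L11 (\<lambda>j. cis (\<alpha> j))) \<and>
    \<not> butson_type (L11 (\<lambda>j. cis (\<alpha> j)))"
proof -
  obtain \<alpha> where approx: "\<forall>j<5. \<bar>2 * cos (\<alpha> j) - a0 j\<bar> \<le> 1/10000 \<and> \<bar>2 * sin (\<alpha> j) - b0 j\<bar> \<le> 1/10000"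
    and res: "\<forall>k<10. residual (\<lambda>j. 2 * cos (\<alpha> j)) (\<lambda>j. 2 * sin (\<alpha> j)) k = 0"
    using exists_angles by blast
  have c: "approx_phases (\<lambda>j. cis (\<alpha> j))"
    using approx by (simp add: approx_phases_def)
  define x y where "x j = cos (\<alpha> j)" and "y j = sin (\<alpha> j)" for j
  have circle: "y j * y j = 1 - x j * x j" for j
    using sin_cos_squared_add[of "\<alpha> j"] by (simp add: x_def y_def power2_eq_square)
  have squares: "x 0 * x 0 + x 1 * x 1 + x 2 * x 2 + x 3 * x 3 + x 4 * x 4 = 9/4"
    using residual_square_sum[OF res] unfolding sum_lt5 by (simp add: x_def power2_eq_square)
  have eqs: "x 0 + x 1 + x 2 + x 3 + x 4 = - 1/2"
    "x 0 * x 1 + x 1 * x 2 + x 2 * x 3 + x 3 * x 4 + x 4 * x 0 = - 1/2"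
    "x 0 * x 2 + x 1 * x 3 + x 2 * x 4 + x 3 * x 0 + x 4 * x 1 = - 1/2"
    "y 0 * y 1 + y 1 * y 2 + y 2 * y 3 + y 3 * y 4 + y 4 * y 0 = 0"
    "y 0 * y 2 + y 1 * y 3 + y 2 * y 4 + y 3 * y 0 + y 4 * y 1 = 0"
    using res[unfolded all_lt10] by (simp_all add: residual_def x_def y_def)
  have sum1: "(\<Sum>j<5. cos (\<alpha> j)) = - 1/2"
    using eqs(1) unfolding sum_lt5 by (simp add: x_def)
  have "cos (2 * \<alpha> j) = 2 * (x j * x j) - 1" for j
    by (simp add: cos_double_cos x_def power2_eq_square)
  then have sum2: "(\<Sum>j<5. cos (2 * \<alpha> j)) = - 1/2"
    using squares unfolding sum_lt5 by simp
  \<comment> \<open>The sine products sum to 0, so angle sums and angle differences both yield the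
    sum of the cosine products, -1/2.\<close>
  have add: "cos (\<alpha> i + \<alpha> j) = x i * x j - y i * y j"
    and diff: "cos (\<alpha> i - \<alpha> j) = x i * x j + y i * y j" for i j
    by (simp_all add: cos_add cos_diff x_def y_def)
  have sum3: "\<forall>i\<in>{0, 1}. (\<Sum>j<5. cos (\<alpha> j + \<alpha> ((j + 1 + i) mod 5))) = - 1/2"
    unfolding sum_lt5 add using eqs by (simp add: numeral_2_eq_2[symmetric])
  have sum4: "\<forall>i\<in>{0, 1}. (\<Sum>j<5. cos (\<alpha> j - \<alpha> ((j + 1 + i) mod 5))) = - 1/2"
    unfolding sum_lt5 diff using eqs by (simp add: numeral_2_eq_2[symmetric])
  have hadamard: "complex_hadamard (L11 (\<lambda>j. cis (\<alpha> j)))"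
    using res by (rule complex_hadamard_L11)
  have "(\<Sum>j<5. 2 * Re (cis (\<alpha> j))) = - 1"
    using sum1 by (simp add: sum_distrib_left[symmetric])
  then have "\<not> butson_type (L11 (\<lambda>j. cis (\<alpha> j)))"
    by (rule not_butson_L11[OF c])
  then show ?thesis
    using sum1 sum2 sum3 sum4 hadamard isolated_L11[OF c hadamard] by blast
qed

end
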